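(* Let $E/\mathbb{Q}$ be the elliptic curve $y^2=x^3+a_4x+a_6$ with $a_4,a_6\in\mathbb{Z}$. Let $(u,v)\in\mathbb{Z}^2$ be map-suitable for $E$, and suppose that $-D_E(u,v)$ is a negative fundamental discriminant. Then the map $\Phi_{u,v}:E(\mathbb{Q})\to \mathrm{CL}(-D_E(u,v))$ is a group homomorphism.
   Context: For integers $u,v$ put $d_E(u,v):=v(u^3+a_4uv^2-a_6v^3)$ and $D_E(u,v):=4d_E(u,v)$. A pair $(u,v)\in\mathbb{Z}^2$ is called map-suitable for $E$ if $u$, $v$, $3u^2+a_4v^2$ and $D_E(u,v)$ are all positive. The class group $\mathrm{CL}(-D)$ is identified with the group of $\mathrm{SL}_2(\mathbb{Z})$-classes of primitive positive definite integral binary quadratic forms of discriminant $-D$ (Gauss composition). Every point $P\neq\mathcal{O}$ of $E(\mathbb{Q})$ can be written uniquely as $P=(A/C^2,B/C^3)$ with $A,B,C\in\mathbb{Z}$, $C>0$, $\gcd(A,C)=\gcd(B,C)=1$. For such $P$ set $a:=Av+C^2u$, $g:=\gcd(C,v)$, choose an integer $\mu$ with $\frac{C^3}{g^2}\mu\equiv 1\pmod{\frac{va}{g^2}}$, and let $\Phi_{u,v}(P)$ be the class of the form $$\frac{va}{g^2}x^2+2\mu\frac{Bv^2}{g^2}xy+\frac{\mu^2\frac{B^2v^4}{g^4}+d_E(u,v)}{\frac{va}{g^2}}y^2,$$ which is a positive definite integral form of discriminant $-D_E(u,v)$ whose class does not depend on the choice of $\mu$; set $\Phi_{u,v}(\mathcal{O})$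 to be the identity class. *)

theory Defs
  imports Complex_Main "HOL-Computational_Algebra.Squarefree"
begin

datatype ecpt = Inf | Pt rat rat

definition ec_nonsingular :: "int \<Rightarrow> int \<Rightarrow> bool" where
  "ec_nonsingular a4 a6 \<longleftrightarrow> 4 * a4^3 + 27 * a6^2 \<noteq> 0"

fun on_curve :: "int \<Rightarrow> int \<Rightarrow> ecpt \<Rightarrow> bool" where
  "on_curve a4 a6 Inf = True"
| "on_curve a4 a6 (Pt x y) \<longleftrightarrow> y^2 = x^3 + of_int a4 * x + of_int a6"

fun ec_add :: "int \<Rightarrow> ecpt \<Rightarrow> ecpt \<Rightarrow> ecpt" where
  "ec_add a4 Inf Q = Q"
| "ec_add a4 (Pt x1 y1) Inf = Pt x1 y1"
| "ec_add a4 (Pt x1 y1) (Pt x2 y2) =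
     (if x1 = x2 \<and> y1 = - y2 then Inf
      else let l = (if x1 = x2 then (3 * x1^2 + of_int a4) / (2 * y1)
                    else (y2 - y1) / (x2 - x1));
               x3 = l^2 - x1 - x2
           in Pt x3 (l * (x1 - x3) - y1))"

type_synonym qform = "int \<times> int \<times> int"

definition sl2_act :: "qform \<Rightarrow> int \<Rightarrow> int \<Rightarrow> int \<Rightarrow> int \<Rightarrow> qform" where
  "sl2_act f p q r s = (case f of (a, b, c) \<Rightarrow>
     (a * p^2 + b * p * r + c * r^2,
      2 * a * p * q + b * (p * s + q * r) + 2 * c * r * s,
      a * q^2 + b * q * s + c * s^2))"

definition form_equiv :: "qform \<Rightarrow> qform \<Rightarrow> bool" where
  "form_equiv f g \<longleftrightarrow> (\<exists>p q r s. p * s - q * r = 1 \<and> g = sl2_act f p q r s)"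

definition form_class :: "qform \<Rightarrow> qform set" where
  "form_class f = {g. form_equiv f g}"

definition disc :: "qform \<Rightarrow> int" where
  "disc f = (case f of (a, b, c) \<Rightarrow> b^2 - 4 * a * c)"

definition primitive_form :: "qform \<Rightarrow> bool" where
  "primitive_form f = (case f of (a, b, c) \<Rightarrow> gcd a (gcd b c) = 1)"

definition pos_def_form :: "qform \<Rightarrow> bool" where
  "pos_def_form f = (case f of (a, b, c) \<Rightarrow> a > 0 \<and> b^2 - 4 * a * c < 0)"

definition class_group :: "int \<Rightarrow> qform set set" where
  "class_group \<Delta> = {form_class f | f. primitive_form f \<and> pos_def_form f \<and> disc f = \<Delta>}"

text \<open>Gauss composition, computed via Dirichlet composition of united representatives:
  if (a1, B, a2 C) is in F1 and (a2, B, a1 C) is in F2 with a1, a2 > 0 coprime,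
  then F1 * F2 is the class of (a1 a2, B, C).\<close>
definition class_mult :: "qform set \<Rightarrow> qform set \<Rightarrow> qform set" where
  "class_mult F1 F2 = (THE F3. \<exists>a1 a2 B C. a1 > 0 \<and> a2 > 0 \<and> coprime a1 a2 \<and>
       (a1, B, a2 * C) \<in> F1 \<and> (a2, B, a1 * C) \<in> F2 \<and> F3 = form_class (a1 * a2, B, C))"

definition fundamental_disc :: "int \<Rightarrow> bool" where
  "fundamental_disc \<Delta> \<longleftrightarrow>
     (\<Delta> mod 4 = 1 \<and> squarefree \<Delta>) \<or>
     (\<exists>m. \<Delta> = 4 * m \<and> (m mod 4 = 2 \<or> m mod 4 = 3) \<and> squarefree m)"

definition dE :: "int \<Rightarrow> int \<Rightarrow> int \<Rightarrow> int \<Rightarrow> int" where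
  "dE a4 a6 u v = v * (u^3 + a4 * u * v^2 - a6 * v^3)"

definition DE :: "int \<Rightarrow> int \<Rightarrow> int \<Rightarrow> int \<Rightarrow> int" where
  "DE a4 a6 u v = 4 * dE a4 a6 u v"

definition map_suitable :: "int \<Rightarrow> int \<Rightarrow> int \<Rightarrow> int \<Rightarrow> bool" where
  "map_suitable a4 a6 u v \<longleftrightarrow> u > 0 \<and> v > 0 \<and> 3 * u^2 + a4 * v^2 > 0 \<and> DE a4 a6 u v > 0"

definition pt_rep :: "rat \<Rightarrow> rat \<Rightarrow> int \<times> int \<times> int \<Rightarrow> bool" where
  "pt_rep x y t = (case t of (A, B, C) \<Rightarrow>
     C > 0 \<and> coprime A C \<and> coprime B C \<and>
     x = of_int A / of_int (C^2) \<and> y = of_int B / of_int (C^3))"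

definition Phi_form :: "int \<Rightarrow> int \<Rightarrow> int \<Rightarrow> int \<Rightarrow> int \<times> int \<times> int \<Rightarrow> int \<Rightarrow> qform" where
  "Phi_form a4 a6 u v t \<mu> = (case t of (A, B, C) \<Rightarrow>
     let a = A * v + C^2 * u; g = gcd C v; m = v * a div g^2 in
     (m, 2 * \<mu> * (B * v^2 div g^2),
      (\<mu>^2 * (B^2 * v^4 div g^4) + dE a4 a6 u v) div m))"

fun Phi :: "int \<Rightarrow> int \<Rightarrow> int \<Rightarrow> int \<Rightarrow> ecpt \<Rightarrow> qform set" where
  "Phi a4 a6 u v Inf = form_class (1, 0, dE a4 a6 u v)"
| "Phi a4 a6 u v (Pt x y) =
     (let t = (SOME t. pt_rep x y t) in
      case t of (A, B, C) \<Rightarrow>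
        let a = A * v + C^2 * u; g = gcd C v;
            \<mu> = (SOME \<mu>. (C^3 div g^2 * \<mu>) mod (v * a div g^2) = 1 mod (v * a div g^2))
        in form_class (Phi_form a4 a6 u v t \<mu>))"

end

theory Submission
  imports Defs "HOL-Library.Set_Algebras"
begin

text \<open>
  Write \<open>w = \<surd>-d\<close> with \<open>d = d\<^sub>E(u, v)\<close>. The point \<open>T = (-u/v, -w/v\<^sup>2)\<close> lies on the curve over
  \<open>\<rat>(w)\<close>, and the form attached to \<open>P = (x, y)\<close> belongs to the ideal \<open>I\<^sub>P\<close> generated, up to a rational
  factor, by \<open>x - x\<^sub>T\<close> divided by the denominator \<open>C\<close> and by \<open>y - y\<^sub>T\<close>. If \<open>P\<close>, \<open>Q\<close>, \<open>R\<close> lie on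
  the line \<open>y = l x + n\<close>, then \<open>\<lambda> = l x\<^sub>T + n - y\<^sub>T\<close> has norm
  \<open>(x\<^sub>P - x\<^sub>T) (x\<^sub>Q - x\<^sub>T) (x\<^sub>R - x\<^sub>T)\<close>. After clearing denominators, \<open>I\<^sub>P I\<^sub>Q I\<^sub>R\<close> is contained in the principal
  ideal of \<open>\<lambda>\<close>, which is checked prime by prime. Since the discriminant is fundamental every form is
  primitive, so an ideal times its conjugate is generated by its norm; comparing norms, the inclusion is an
  equality. Replacing \<open>I\<^sub>R\<close> by its conjugate turns this into \<open>I\<^sub>P I\<^sub>Q \<sim> I\<^bsub>P+Q\<^esub>\<close>, and Dirichlet composition of
  forms is multiplication of ideals.
\<close>

section \<open>Lattices and ideals of binary quadratic forms\<close>

text \<open>Since the discriminant is \<open>-4 * d\<close>, middle coefficients are even, and a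
  form \<open>(a, 2 * b, c)\<close> becomes the lattice spanned by \<open>a\<close> and
  \<open>b + w\<close> in the order Z[w]. Lattices are spans of generator sets and their products
  are spans of product sets, so every inclusion is a check on generators. The scaling of
  \<open>\<lambda>\<close> that gives it norm \<open>m1 * m2 * m3\<close> is
  \<open>v^3 * C1 * C2 * C3 / (g1 * g2 * g3)\<close> with \<open>gi = gcd Ci v\<close>, because
  \<open>Ci^2 * (xi - X) = mi * gi^2 / v^2\<close> for the leading coefficient \<open>mi\<close>.
  Two kinds of primes need different arguments. Away from \<open>v\<close> the point
  \<open>T\<close> is integral, and the quotients to be bounded are polynomials in the coordinates.
  At a prime \<open>p\<close> dividing \<open>v\<close> the point \<open>T\<close> is not integral;
  there squarefreeness of \<open>d\<close> forces \<open>p\<close> to divide \<open>v\<close>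
  exactly once and not to divide \<open>u\<close>. Such a \<open>p\<close> ramifies, and the
  argument is a count of powers of \<open>p\<close>.\<close>

inductive_set zspan :: "complex set \<Rightarrow> complex set" for G where
  zspan_zero: "0 \<in> zspan G"
| zspan_add_gen: "x \<in> zspan G \<Longrightarrow> g \<in> G \<Longrightarrow> x + g \<in> zspan G"
| zspan_diff_gen: "x \<in> zspan G \<Longrightarrow> g \<in> G \<Longrightarrow> x - g \<in> zspan G"

lemma zspan_gen: "g \<in> G \<Longrightarrow> g \<in> zspan G"
  using zspan_add_gen[OF zspan_zero] by simp

lemma zspan_add:
  assumes "x \<in> zspan G" and "y \<in> zspan G"
  shows "x + y \<in> zspan G"
  using assms(2)
proof (induction y rule: zspan.induct)
  case (zspan_add_gen y g)
  then show ?case using zspan.zspan_add_gen[of "x + y"] by (simp add: add.assoc)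
next
  case (zspan_diff_gen y g)
  then show ?case using zspan.zspan_diff_gen[of "x + y"] by (simp add: algebra_simps)
qed (simp add: assms(1))

lemma zspan_minus: "x \<in> zspan G \<Longrightarrow> - x \<in> zspan G"
proof (induction x rule: zspan.induct)
  case (zspan_add_gen y g)
  then show ?case using zspan.zspan_diff_gen[of "- y"] by simp
next
  case (zspan_diff_gen y g)
  then show ?case using zspan.zspan_add_gen[of "- y"] by (simp add: algebra_simps)
qed (simp add: zspan_zero)

lemma zspan_diff: "x \<in> zspan G \<Longrightarrow> y \<in> zspan G \<Longrightarrow> x - y \<in> zspan G"
  using zspan_add[of x G "- y"] zspan_minus[of y G] by simp

lemma zspan_of_int_mult:
  assumes "x \<in> zspan G"
  shows "of_int n * x \<in> zspan G"
proof -
  have nat: "of_nat k * x \<in> zspan G" for k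
    by (induction k) (auto simp: algebra_simps zspan_zero intro: zspan_add assms)
  show ?thesis
  proof (cases "n \<ge> 0")
    case True
    then show ?thesis using nat[of "nat n"] by simp
  next
    case False
    then have "of_int n * x = - (of_nat (nat (- n)) * x)" by simp
    then show ?thesis using zspan_minus[OF nat] by metis
  qed
qed

lemma zspan_least: "G \<subseteq> zspan H \<Longrightarrow> zspan G \<subseteq> zspan H"
proof
  fix x assume "G \<subseteq> zspan H" and "x \<in> zspan G"
  from this(2,1) show "x \<in> zspan H"
    by (induction x rule: zspan.induct) (auto intro: zspan_zero zspan_add zspan_diff)
qed

lemma zspan_eqI: "G \<subseteq> zspan H \<Longrightarrow> H \<subseteq> zspan G \<Longrightarrow> zspan G = zspan H"
  by (simp add: zspan_least subset_antisym)

lemma zspan_mult_gen: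
  assumes "g \<in> G" and "y \<in> zspan H"
  shows "g * y \<in> zspan (G * H)"
  using assms(2)
proof (induction y rule: zspan.induct)
  case (zspan_add_gen y h)
  then show ?case using zspan.zspan_add_gen[of "g * y" "G * H" "g * h"] assms(1)
    by (auto simp: algebra_simps)
next
  case (zspan_diff_gen y h)
  then show ?case using zspan.zspan_diff_gen[of "g * y" "G * H" "g * h"] assms(1)
    by (auto simp: algebra_simps)
qed (simp add: zspan_zero)

lemma zspan_mult:
  assumes "x \<in> zspan G" and "y \<in> zspan H"
  shows "x * y \<in> zspan (G * H)"
  using assms(1)
proof (induction x rule: zspan.induct)
  case (zspan_add_gen x g)
  then show ?case using zspan_add zspan_mult_gen[OF _ assms(2)] by (simp add: algebra_simps)
next
  case (zspan_diff_gen x g)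
  then show ?case using zspan_diff zspan_mult_gen[OF _ assms(2)] by (simp add: algebra_simps)
qed (simp add: zspan_zero)

text \<open>Products of lattices are formed on generators; this and the congruence below make the
  result depend on the spans only.\<close>

lemma zspan_times_mono:
  assumes "zspan A \<subseteq> zspan B"
  shows "zspan (A * C) \<subseteq> zspan (B * C)"
proof (rule zspan_least)
  show "A * C \<subseteq> zspan (B * C)"
    using assms by (fastforce elim!: set_times_elim intro: zspan_mult zspan_gen)
qed

lemma zspan_times_cong:
  assumes "zspan A = zspan B"
  shows "zspan (A * C) = zspan (B * C)"
  using assms by (simp add: zspan_times_mono subset_antisym)

lemma zspan_scale: "zspan ({\<alpha>} * G) = {\<alpha>} * zspan G"
proof
  have "x \<in> {\<alpha>} * zspan G" if "x \<in> zspan ({\<alpha>} * G)" for x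
    using that
  proof (induction x rule: zspan.induct)
    case zspan_zero
    then show ?case using zspan.zspan_zero by (force simp: set_times_def)
  next
    case (zspan_add_gen x g)
    then obtain y h where "y \<in> zspan G" "h \<in> G" "x = \<alpha> * y" "g = \<alpha> * h"
      by (auto simp: set_times_def)
    then show ?case using zspan.zspan_add_gen[of y G h]
      by (auto simp: set_times_def ring_distribs intro!: bexI[of _ "y + h"])
  next
    case (zspan_diff_gen x g)
    then obtain y h where "y \<in> zspan G" "h \<in> G" "x = \<alpha> * y" "g = \<alpha> * h"
      by (auto simp: set_times_def)
    then show ?case using zspan.zspan_diff_gen[of y G h]
      by (auto simp: set_times_def ring_distribs intro!: bexI[of _ "y - h"])
  qed
  then show "zspan ({\<alpha>} * G) \<subseteq> {\<alpha>} * zspan G" by blast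
  show "{\<alpha>} * zspan G \<subseteq> zspan ({\<alpha>} * G)"
    by (auto elim!: set_times_elim intro: zspan_mult zspan_gen)
qed

lemma zspan_scale_cancel:
  assumes "\<alpha> \<noteq> 0" and "zspan ({\<alpha>} * G) \<subseteq> zspan ({\<alpha>} * H)"
  shows "zspan G \<subseteq> zspan H"
proof
  fix x assume "x \<in> zspan G"
  then have "\<alpha> * x \<in> {\<alpha>} * zspan H"
    using assms(2) by (auto simp: zspan_scale)
  then show "x \<in> zspan H" using assms(1) by (auto simp: set_times_def)
qed

lemma zspan_doubleton: "x \<in> zspan {a, b} \<longleftrightarrow> (\<exists>m n. x = of_int m * a + of_int n * b)"
proof
  assume "x \<in> zspan {a, b}"
  then show "\<exists>m n. x = of_int m * a + of_int n * b"
  proof (induction x rule: zspan.induct)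
    case zspan_zero
    then show ?case by (intro exI[of _ 0]) simp
  next
    case (zspan_add_gen x g)
    then obtain m n where "x = of_int m * a + of_int n * b" by blast
    then have "x + a = of_int (m + 1) * a + of_int n * b" "x + b = of_int m * a + of_int (n + 1) * b"
      by (simp_all add: algebra_simps)
    then show ?case using zspan_add_gen.hyps by blast
  next
    case (zspan_diff_gen x g)
    then obtain m n where "x = of_int m * a + of_int n * b" by blast
    then have "x - a = of_int (m - 1) * a + of_int n * b" "x - b = of_int m * a + of_int (n - 1) * b"
      by (simp_all add: algebra_simps)
    then show ?case using zspan_diff_gen.hyps by blast
  qed
next
  assume "\<exists>m n. x = of_int m * a + of_int n * b"
  moreover have "a \<in> zspan {a, b}" "b \<in> zspan {a, b}" by (simp_all add: zspan_gen)
  ultimately show "x \<in> zspan {a, b}" using zspan_add zspan_of_int_mult by blast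
qed

section \<open>The rank-two lattices attached to forms of discriminant -4d\<close>

definition sqrt_neg :: "int \<Rightarrow> complex" where
  "sqrt_neg d = \<i> * of_real (sqrt (of_int d))"

text \<open>The third coefficient is left out because \<open>a * c = b^2 + d\<close> determines it;
  that relation is also what makes the lattice an ideal of Z[w]. For \<open>a > 0\<close> the
  ordered basis is positively oriented.\<close>

definition form_gens :: "int \<Rightarrow> int \<Rightarrow> int \<Rightarrow> complex set" where
  "form_gens d a b = {of_int a, of_int b + sqrt_neg d}"

lemma sqrt_neg_square: "d > 0 \<Longrightarrow> sqrt_neg d * sqrt_neg d = - of_int d"
proof -
  assume "d > 0"
  then have "complex_of_real (sqrt (of_int d)) * of_real (sqrt (of_int d)) = of_int d"
    by (metis of_int_0_le_iff of_real_mult of_real_of_int_eq order_less_imp_le real_sqrt_mult_self abs_of_nonneg)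
  then show ?thesis by (simp add: sqrt_neg_def algebra_simps)
qed

lemma cnj_sqrt_neg [simp]: "cnj (sqrt_neg d) = - sqrt_neg d"
  by (simp add: sqrt_neg_def)

lemma sqrt_neg_components [simp]: "Re (sqrt_neg d) = 0" "Im (sqrt_neg d) = sqrt (of_int d)"
  by (simp_all add: sqrt_neg_def)

lemma sqrt_neg_coords_eq:
  assumes "d > 0" and "of_real x + of_real y * sqrt_neg d = of_real x' + of_real y' * sqrt_neg d"
  shows "x = x' \<and> y = y'"
  using assms(2)[unfolded complex_eq_iff] assms(1) by simp

text \<open>The square of \<open>b + w\<close> reduces to
  \<open>- C * (a1 * a2) + 2 * b * (b + w)\<close>, which gives one inclusion. For the other, a
  Bezout relation between \<open>a1\<close> and \<open>a2\<close> recovers \<open>b + w\<close> from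
  its multiples by \<open>a1\<close> and \<open>a2\<close>.\<close>

lemma form_gens_dirichlet:
  assumes d: "d > 0" and "coprime a1 a2" and C: "a1 * a2 * C = b^2 + d"
  shows "zspan (form_gens d a1 b * form_gens d a2 b) = zspan (form_gens d (a1 * a2) b)"
proof (rule zspan_eqI)
  let ?w = "sqrt_neg d"
  let ?P = "form_gens d a1 b * form_gens d a2 b"
  have Cc: "of_int a1 * of_int a2 * of_int C = (of_int b)^2 + (of_int d :: complex)"
    using arg_cong[OF C, of "of_int :: int \<Rightarrow> complex"] by simp
  have sq: "(of_int b + ?w) * (of_int b + ?w) = of_int (-C) * of_int (a1 * a2) + of_int (2 * b) * (of_int b + ?w)"
    using sqrt_neg_square[OF d] Cc by (simp add: algebra_simps power2_eq_square)
  have Q: "of_int (a1 * a2) \<in> zspan (form_gens d (a1 * a2) b)"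
      "of_int b + ?w \<in> zspan (form_gens d (a1 * a2) b)"
    by (simp_all add: form_gens_def zspan_gen)
  then have "of_int a1 * of_int a2 \<in> zspan (form_gens d (a1 * a2) b)"
      "of_int a1 * (of_int b + ?w) \<in> zspan (form_gens d (a1 * a2) b)"
      "of_int a2 * (of_int b + ?w) \<in> zspan (form_gens d (a1 * a2) b)"
      "(of_int b + ?w) * (of_int b + ?w) \<in> zspan (form_gens d (a1 * a2) b)"
    unfolding sq using zspan_add zspan_of_int_mult by (simp, blast+)
  then show "?P \<subseteq> zspan (form_gens d (a1 * a2) b)"
    unfolding form_gens_def[of d a1] form_gens_def[of d a2] by (auto simp: set_times_def mult.commute)
  have gens: "of_int a1 * of_int a2 \<in> zspan ?P" "of_int a1 * (of_int b + ?w) \<in> zspan ?P"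
      "of_int a2 * (of_int b + ?w) \<in> zspan ?P"
    by (rule zspan_gen, force simp: set_times_def form_gens_def mult.commute)+
  obtain r s where rs: "r * a1 + s * a2 = 1"
    using bezout_int[of a1 a2] \<open>coprime a1 a2\<close> by auto
  have "of_int b + ?w = of_int (r * a1 + s * a2) * (of_int b + ?w)" using rs by simp
  also have "\<dots> = of_int r * (of_int a1 * (of_int b + ?w)) + of_int s * (of_int a2 * (of_int b + ?w))"
    by (simp add: algebra_simps)
  also have "\<dots> \<in> zspan ?P" by (intro zspan_add zspan_of_int_mult gens)
  finally show "form_gens d (a1 * a2) b \<subseteq> zspan ?P"
    using gens(1) by (auto simp: form_gens_def)
qed

text \<open>\<open>form_gens d 1 0\<close> spans the order itself, so this is stability of the
  lattice under Z[w]. It is Dirichlet composition with \<open>a1 = 1\<close>, after replacing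
  \<open>w\<close> by \<open>b + w\<close> in the basis of the order.\<close>

lemma form_gens_unit:
  assumes d: "d > 0" and C: "a * c = b^2 + d"
  shows "zspan (form_gens d 1 0 * form_gens d a b) = zspan (form_gens d a b)"
proof -
  have "zspan (form_gens d 1 b * form_gens d a b) = zspan (form_gens d a b)"
    using form_gens_dirichlet[OF d, of 1 a c b] C by simp
  moreover have "zspan (form_gens d 1 0) = zspan (form_gens d 1 b)"
  proof (rule zspan_eqI)
    have *: "1 \<in> zspan (form_gens d 1 c)" "of_int c + sqrt_neg d \<in> zspan (form_gens d 1 c)" for c
      by (simp_all add: form_gens_def zspan_gen)
    have "sqrt_neg d = (of_int b + sqrt_neg d) - of_int b * 1" by simp
    then have "sqrt_neg d \<in> zspan (form_gens d 1 b)"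
      using zspan_diff[OF *(2) zspan_of_int_mult[OF *(1)]] by metis
    then show "form_gens d 1 0 \<subseteq> zspan (form_gens d 1 b)"
      using *[of b] by (simp add: form_gens_def)
    have "of_int b + sqrt_neg d \<in> zspan (form_gens d 1 0)"
      using zspan_add[OF zspan_of_int_mult[OF *(1)[of 0], of b] *(2)[of 0]] by simp
    then show "form_gens d 1 b \<subseteq> zspan (form_gens d 1 0)"
      using *[of 0] by (simp add: form_gens_def)
  qed
  ultimately show ?thesis using zspan_times_cong by metis
qed

text \<open>The conjugate lattice is generated by \<open>a\<close> and \<open>- b + w\<close>, the
  negative of the conjugate of \<open>b + w\<close>. The product contains \<open>a * a\<close>,
  \<open>a * (2 * b)\<close> and \<open>a * c\<close> up to sign, hence \<open>a\<close> times the
  gcd of the coefficients, which primitivity makes equal to \<open>a\<close>.\<close>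

lemma form_gens_conj:
  assumes d: "d > 0" and C: "a * c = b^2 + d" and prim: "primitive_form (a, 2 * b, c)"
  shows "zspan (form_gens d a b * form_gens d a (- b)) = zspan ({of_int a} * form_gens d 1 0)"
proof (rule zspan_eqI)
  let ?w = "sqrt_neg d" and ?a = "of_int a :: complex" and ?b = "of_int b :: complex"
  let ?P = "form_gens d a b * form_gens d a (- b)"
  let ?Q = "{?a} * form_gens d 1 0"
  have Q: "?a \<in> zspan ?Q" "?a * ?w \<in> zspan ?Q"
    by (rule zspan_gen, force simp: set_times_def form_gens_def)+
  have Cc: "?a * of_int c = ?b^2 + of_int d"
    using arg_cong[OF C, of "of_int :: int \<Rightarrow> complex"] by simp
  have e: "?a * (?b + ?w) = of_int b * ?a + ?a * ?w" "?a * (- ?b + ?w) = of_int (-b) * ?a + ?a * ?w"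
    "(?b + ?w) * (- ?b + ?w) = of_int (-c) * ?a"
    using sqrt_neg_square[OF d] Cc by (simp_all add: algebra_simps power2_eq_square)
  have "?a * ?a \<in> zspan ?Q" using zspan_of_int_mult Q(1) by blast
  moreover have "?a * (?b + ?w) \<in> zspan ?Q" "?a * (- ?b + ?w) \<in> zspan ?Q"
    "(?b + ?w) * (- ?b + ?w) \<in> zspan ?Q"
    unfolding e by (intro zspan_add zspan_of_int_mult Q)+
  ultimately show "?P \<subseteq> zspan ?Q"
    by (auto simp: set_times_def form_gens_def mult.commute)
  have P: "?a * ?a \<in> zspan ?P" "?a * (?b + ?w) \<in> zspan ?P" "?a * (- ?b + ?w) \<in> zspan ?P"
     "(?b + ?w) * (- ?b + ?w) \<in> zspan ?P"
    by (rule zspan_gen, force simp: set_times_def form_gens_def mult.commute)+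
  obtain r s where rs: "r * (2 * b) + s * c = gcd (2 * b) c" using bezout_int by blast
  obtain r' s' where "r' * a + s' * gcd (2 * b) c = 1"
    using bezout_int[of a "gcd (2 * b) c"] prim by (auto simp: primitive_form_def)
  then have one: "r' * a + s' * (r * (2 * b) + s * c) = 1" by (simp add: rs)
  have "?a = of_int (r' * a + s' * (r * (2 * b) + s * c)) * ?a" by (simp add: one)
  also have "\<dots> = of_int r' * (?a * ?a) + of_int (s' * r) * (?a * (?b + ?w) - ?a * (- ?b + ?w))
      + of_int (- s' * s) * ((?b + ?w) * (- ?b + ?w))"
    unfolding e by (simp add: algebra_simps)
  also have "\<dots> \<in> zspan ?P" by (intro zspan_add zspan_diff zspan_of_int_mult P)
  finally have a: "?a \<in> zspan ?P" .
  have "?a * ?w = ?a * (?b + ?w) - of_int b * ?a" by (simp add: algebra_simps)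
  also have "\<dots> \<in> zspan ?P" by (intro zspan_diff zspan_of_int_mult P a)
  finally show "?Q \<subseteq> zspan ?P" using a by (auto simp: set_times_def form_gens_def)
qed

section \<open>Equivalence of forms and of ideals\<close>

lemma form_equiv_refl: "form_equiv f f"
  unfolding form_equiv_def sl2_act_def
  by (rule exI[of _ 1], rule exI[of _ 0], rule exI[of _ 0], rule exI[of _ 1]) (cases f, simp)

lemma form_equiv_sym:
  assumes "form_equiv f g"
  shows "form_equiv g f"
proof -
  obtain p q r s where det: "p * s - q * r = 1" and g: "g = sl2_act f p q r s"
    using assms by (auto simp: form_equiv_def)
  obtain a b c where f: "f = (a, b, c)" by (cases f)
  have "sl2_act g s (- q) (- r) p
      = (a * (p * s - q * r)^2, b * (p * s - q * r)^2, c * (p * s - q * r)^2)"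
    unfolding g f sl2_act_def by (simp, intro conjI; algebra)
  then have "sl2_act g s (- q) (- r) p = f" by (simp add: det f)
  moreover have "s * p - (- q) * (- r) = 1" using det by (simp add: algebra_simps)
  ultimately show ?thesis unfolding form_equiv_def by metis
qed

lemma form_equiv_trans:
  assumes "form_equiv f g" and "form_equiv g h"
  shows "form_equiv f h"
proof -
  obtain p q r s where det: "p * s - q * r = 1" and g: "g = sl2_act f p q r s"
    using assms(1) by (auto simp: form_equiv_def)
  obtain p' q' r' s' where det': "p' * s' - q' * r' = 1" and h: "h = sl2_act g p' q' r' s'"
    using assms(2) by (auto simp: form_equiv_def)
  obtain a b c where f: "f = (a, b, c)" by (cases f)
  have "h = sl2_act f (p * p' + q * r') (p * q' + q * s') (r * p' + s * r') (r * q' + s * s')"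
    unfolding g h f sl2_act_def by (simp, intro conjI; algebra)
  moreover have "(p * p' + q * r') * (r * q' + s * s') - (p * q' + q * s') * (r * p' + s * r')
      = (p * s - q * r) * (p' * s' - q' * r')"
    by algebra
  ultimately show ?thesis unfolding form_equiv_def det det' by fastforce
qed

lemma form_class_eq_iff: "form_class f = form_class g \<longleftrightarrow> form_equiv f g"
  unfolding form_class_def using form_equiv_refl form_equiv_sym form_equiv_trans by blast

lemma mem_form_class: "g \<in> form_class f \<longleftrightarrow> form_equiv f g"
  by (simp add: form_class_def)

lemma disc_sl2_act: "disc (sl2_act f p q r s) = (p * s - q * r)^2 * disc f"
proof -
  obtain a b c where f: "f = (a, b, c)" by (cases f)
  show ?thesis unfolding f disc_def sl2_act_def prod.case by algebra
qed

lemma disc_form_equiv: "form_equiv f g \<Longrightarrow> disc g = disc f"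
  by (auto simp: form_equiv_def disc_sl2_act)

text \<open>Homothety, with a factor on each side so that symmetry is immediate and no division
  enters. Complex multiplication preserves orientation, so this matches proper equivalence of forms
  with positive leading coefficient.\<close>

definition ideal_equiv :: "complex set \<Rightarrow> complex set \<Rightarrow> bool" where
  "ideal_equiv G H \<longleftrightarrow> (\<exists>\<alpha> \<beta>. \<alpha> \<noteq> 0 \<and> \<beta> \<noteq> 0 \<and> zspan ({\<alpha>} * G) = zspan ({\<beta>} * H))"

lemma ideal_equiv_sym: "ideal_equiv G H \<Longrightarrow> ideal_equiv H G"
  unfolding ideal_equiv_def by metis

lemma ideal_equiv_zspan_eq: "zspan G = zspan H \<Longrightarrow> ideal_equiv G H"
  unfolding ideal_equiv_def by (intro exI[of _ 1]) (simp add: zspan_scale)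

lemma ideal_equiv_times:
  assumes "ideal_equiv G H"
  shows "ideal_equiv (G * K) (H * K)"
proof -
  obtain \<alpha> \<beta> where "\<alpha> \<noteq> 0" "\<beta> \<noteq> 0" "zspan ({\<alpha>} * G) = zspan ({\<beta>} * H)"
    using assms by (auto simp: ideal_equiv_def)
  then show ?thesis unfolding ideal_equiv_def
    using zspan_times_cong[of "{\<alpha>} * G" "{\<beta>} * H" K] by (metis mult.assoc)
qed

lemma set_times_singletons: "{a} * {b} = {a * b :: complex}"
  by (auto simp: set_times_def)

lemma ideal_equiv_trans:
  assumes "ideal_equiv G H" and "ideal_equiv H K"
  shows "ideal_equiv G K"
proof -
  obtain \<alpha> \<beta> where 1: "\<alpha> \<noteq> 0" "\<beta> \<noteq> 0" "zspan ({\<alpha>} * G) = zspan ({\<beta>} * H)"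
    using assms(1) by (auto simp: ideal_equiv_def)
  obtain \<gamma> \<delta> where 2: "\<gamma> \<noteq> 0" "\<delta> \<noteq> 0" "zspan ({\<gamma>} * H) = zspan ({\<delta>} * K)"
    using assms(2) by (auto simp: ideal_equiv_def)
  have "zspan ({\<gamma> * \<alpha>} * G) = zspan ({\<alpha>} * G * {\<gamma>})"
    by (simp add: mult_ac flip: set_times_singletons)
  also have "\<dots> = zspan ({\<beta>} * H * {\<gamma>})" by (rule zspan_times_cong[OF 1(3)])
  also have "\<dots> = zspan ({\<gamma>} * H * {\<beta>})" by (simp add: mult_ac)
  also have "\<dots> = zspan ({\<delta>} * K * {\<beta>})" by (rule zspan_times_cong[OF 2(3)])
  also have "\<dots> = zspan ({\<delta> * \<beta>} * K)" by (simp add: mult_ac flip: set_times_singletons)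
  finally show ?thesis unfolding ideal_equiv_def using 1 2 by (metis mult_eq_0_iff)
qed

lemma form_equiv_imp_ideal_equiv:
  assumes d: "d > 0" and a: "a > 0" and C: "a * c = b^2 + d"
    and eq: "form_equiv (a, 2 * b, c) (a', 2 * b', c')"
  shows "ideal_equiv (form_gens d a b) (form_gens d a' b')"
proof -
  obtain p q r s where det: "p * s - q * r = 1"
    and g: "(a', 2 * b', c') = sl2_act (a, 2 * b, c) p q r s"
    using eq by (auto simp: form_equiv_def)
  let ?w = "sqrt_neg d"
  let ?a = "of_int a :: complex" and ?b = "of_int b :: complex" and ?a' = "of_int a' :: complex"
    and ?b' = "of_int b' :: complex" and ?p = "of_int p :: complex" and ?q = "of_int q :: complex"
    and ?r = "of_int r :: complex" and ?s = "of_int s :: complex"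
    and ?c = "of_int c :: complex" and ?d = "of_int d :: complex"
  have a': "a' = a * p^2 + 2 * b * p * r + c * r^2"
    and "2 * b' = 2 * (a * p * q + b * (p * s + q * r) + c * r * s)"
    using g by (simp_all add: sl2_act_def algebra_simps)
  then have b': "b' = a * p * q + b * (p * s + q * r) + c * r * s" by simp
  have A: "?a' = ?a * ?p^2 + 2 * ?b * ?p * ?r + ?c * ?r^2"
    and B: "?b' = ?a * ?p * ?q + ?b * (?p * ?s + ?q * ?r) + ?c * ?r * ?s"
    unfolding a' b' by simp_all
  have ac: "?a * ?c = ?b^2 + ?d" using arg_cong[OF C, of "of_int :: int \<Rightarrow> complex"] by simp
  have D: "?p * ?s - ?q * ?r = 1" using arg_cong[OF det, of "of_int :: int \<Rightarrow> complex"] by simp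
  have w: "?w * ?w = - ?d" by (rule sqrt_neg_square[OF d])
  \<comment> \<open>The conjugate of the new first basis vector \<open>a * p + (b + w) * r\<close>,
    whose norm is \<open>a * a'\<close>. Multiplying the transformed basis by it gives exactly
    \<open>a\<close> times the standard basis of the second form.\<close>
  define \<mu> where "\<mu> = ?a * ?p + (?b - ?w) * ?r"
  have e1: "\<mu> * (?a * ?p + (?b + ?w) * ?r) = ?a * ?a'"
    unfolding \<mu>_def A using ac w by algebra
  have e2: "\<mu> * (?a * ?q + (?b + ?w) * ?s) = ?a * (?b' + ?w)"
    unfolding \<mu>_def B using ac w D by algebra
  have e3: "\<mu> * ?a = ?s * (?a * ?a') - ?r * (?a * (?b' + ?w))"
    unfolding e1[symmetric] e2[symmetric] using D by algebra
  have e4: "\<mu> * (?b + ?w) = ?p * (?a * (?b' + ?w)) - ?q * (?a * ?a')"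
    unfolding e1[symmetric] e2[symmetric] using D by algebra
  have "\<mu> \<noteq> 0"
  proof
    assume "\<mu> = 0"
    then have "?a * (?b' + ?w) = 0" using e2 by simp
    then have "?b' + ?w = 0" using a by simp
    then have "Im (?b' + ?w) = 0" by simp
    then show False using d by simp
  qed
  moreover have "zspan ({\<mu>} * form_gens d a b) = zspan ({?a} * form_gens d a' b')"
  proof (rule zspan_eqI)
    have g': "?a * ?a' \<in> zspan ({?a} * form_gens d a' b')" "?a * (?b' + ?w) \<in> zspan ({?a} * form_gens d a' b')"
      by (rule zspan_gen, simp add: form_gens_def set_times_def)+
    then have "\<mu> * ?a \<in> zspan ({?a} * form_gens d a' b')" "\<mu> * (?b + ?w) \<in> zspan ({?a} * form_gens d a' b')"
      unfolding e3 e4 by (blast intro: zspan_diff zspan_of_int_mult)+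
    then show "{\<mu>} * form_gens d a b \<subseteq> zspan ({?a} * form_gens d a' b')"
      by (auto simp: form_gens_def[of d a b] set_times_def)
    have g: "\<mu> * ?a \<in> zspan ({\<mu>} * form_gens d a b)" "\<mu> * (?b + ?w) \<in> zspan ({\<mu>} * form_gens d a b)"
      by (rule zspan_gen, simp add: form_gens_def set_times_def)+
    have "?a * ?a' = ?p * (\<mu> * ?a) + ?r * (\<mu> * (?b + ?w))"
      "?a * (?b' + ?w) = ?q * (\<mu> * ?a) + ?s * (\<mu> * (?b + ?w))"
      unfolding e1[symmetric] e2[symmetric] by (simp_all add: algebra_simps)
    then have "?a * ?a' \<in> zspan ({\<mu>} * form_gens d a b)" "?a * (?b' + ?w) \<in> zspan ({\<mu>} * form_gens d a b)"
      using g by (metis zspan_add zspan_of_int_mult)+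
    then show "{?a} * form_gens d a' b' \<subseteq> zspan ({\<mu>} * form_gens d a b)"
      by (auto simp: form_gens_def[of d a' b'] set_times_def)
  qed
  moreover have "?a \<noteq> 0" using a by simp
  ultimately show ?thesis unfolding ideal_equiv_def by blast
qed

text \<open>The third conclusion compares signed areas of the two bases, computed as the imaginary
  part of the conjugate of the first vector times the second.\<close>

lemma form_gens_change_of_basis:
  assumes d: "d > 0" and sub: "form_gens d a' b' \<subseteq> H" and H: "{\<beta>} * H = {\<alpha>} * zspan (form_gens d a b)"
  obtains p q r s where
    "\<beta> * of_int a' = \<alpha> * (of_int p * of_int a + of_int r * (of_int b + sqrt_neg d))"
    "\<beta> * (of_int b' + sqrt_neg d) = \<alpha> * (of_int q * of_int a + of_int s * (of_int b + sqrt_neg d))"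
    "(cmod \<beta>)\<^sup>2 * of_int a' = (cmod \<alpha>)\<^sup>2 * (of_int a * of_int (p * s - q * r))"
proof -
  let ?w = "sqrt_neg d"
  have in1: "\<exists>m n. \<beta> * x = \<alpha> * (of_int m * of_int a + of_int n * (of_int b + ?w))"
    if "x \<in> form_gens d a' b'" for x
  proof -
    have "\<beta> * x \<in> {\<alpha>} * zspan (form_gens d a b)" using that sub H by auto
    then obtain z where "z \<in> zspan (form_gens d a b)" "\<beta> * x = \<alpha> * z" by (auto simp: set_times_def)
    then show ?thesis unfolding form_gens_def zspan_doubleton by blast
  qed
  obtain p r where 1: "\<beta> * of_int a' = \<alpha> * (of_int p * of_int a + of_int r * (of_int b + ?w))"
    using in1[of "of_int a'"] by (auto simp: form_gens_def)
  obtain q s where 2: "\<beta> * (of_int b' + ?w) = \<alpha> * (of_int q * of_int a + of_int s * (of_int b + ?w))"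
    using in1[of "of_int b' + ?w"] by (auto simp: form_gens_def)
  have "Im (cnj (\<beta> * of_int a') * (\<beta> * (of_int b' + ?w)))
      = (cmod \<beta>)\<^sup>2 * of_int a' * sqrt (of_int d)"
    unfolding cmod_power2 by (simp add: algebra_simps power2_eq_square)
  moreover have "Im (cnj (\<beta> * of_int a') * (\<beta> * (of_int b' + ?w)))
      = (cmod \<alpha>)\<^sup>2 * (of_int a * of_int (p * s - q * r)) * sqrt (of_int d)"
    unfolding 1 2 cmod_power2 by (simp add: algebra_simps power2_eq_square)
  ultimately have "(cmod \<beta>)\<^sup>2 * of_int a' = (cmod \<alpha>)\<^sup>2 * (of_int a * of_int (p * s - q * r))"
    using d by simp
  then show ?thesis using that 1 2 by blast
qed

text \<open>A form is recovered from its lattice as the norm divided by the leading coefficient, so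
  a base change of determinant 1 between homothetic lattices carries one form to the other.\<close>

lemma ideal_equiv_imp_form_equiv:
  assumes d: "d > 0" and a: "a > 0" and a': "a' > 0"
    and C: "a * c = b^2 + d" and C': "a' * c' = b'^2 + d"
    and eq: "ideal_equiv (form_gens d a b) (form_gens d a' b')"
  shows "form_equiv (a, 2 * b, c) (a', 2 * b', c')"
proof -
  let ?w = "sqrt_neg d"
  obtain \<alpha> \<beta> where nz: "\<alpha> \<noteq> 0" "\<beta> \<noteq> 0"
    and span: "{\<alpha>} * zspan (form_gens d a b) = {\<beta>} * zspan (form_gens d a' b')"
    using eq by (auto simp: ideal_equiv_def zspan_scale)
  have sub: "form_gens d x y \<subseteq> zspan (form_gens d x y)" for x y by (auto intro: zspan_gen)
  obtain p q r s where
    1: "\<beta> * of_int a' = \<alpha> * (of_int p * of_int a + of_int r * (of_int b + ?w))" and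
    2: "\<beta> * (of_int b' + ?w) = \<alpha> * (of_int q * of_int a + of_int s * (of_int b + ?w))" and
    3: "(cmod \<beta>)\<^sup>2 * of_int a' = (cmod \<alpha>)\<^sup>2 * (of_int a * of_int (p * s - q * r))"
    by (rule form_gens_change_of_basis[OF d sub span[symmetric]])
  obtain p' q' r' s' where
    4: "(cmod \<alpha>)\<^sup>2 * of_int a = (cmod \<beta>)\<^sup>2 * (of_int a' * of_int (p' * s' - q' * r'))"
    by (rule form_gens_change_of_basis[OF d sub span])
  define D where "D = p * s - q * r"
  define D' where "D' = p' * s' - q' * r'"
  have pos: "(cmod \<beta>)\<^sup>2 * of_int a' > 0" "(cmod \<alpha>)\<^sup>2 * of_int a > 0" using nz a a' by simp_all
  \<comment> \<open>Inclusions in both directions give integral determinants with product 1;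
    positivity of \<open>a\<close> and \<open>a'\<close> then rules out determinant -1.\<close>
  have "(cmod \<beta>)\<^sup>2 * of_int a' * 1 = (cmod \<beta>)\<^sup>2 * of_int a' * of_int (D' * D)"
    using 3 4 unfolding D_def[symmetric] D'_def[symmetric] of_int_mult[of D' D] by algebra
  then have "real_of_int (D' * D) = 1" using pos(1) by (metis less_irrefl mult_left_cancel)
  then have "D' * D = 1" by linarith
  moreover have "D > 0" using 3 pos by (simp add: D_def[symmetric] zero_less_mult_iff)
  ultimately have D: "D = 1" by (auto simp: zmult_eq_1_iff)
  \<comment> \<open>The common normalisation: on either scaled lattice the squared absolute value of
    a vector is \<open>k\<close> times the value of the corresponding form. The coefficients
    \<open>a'\<close>, \<open>c'\<close>, \<open>b'\<close> are read off below as two norms and one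
    inner product.\<close>
  define k where "k = (cmod \<alpha>)\<^sup>2 * real_of_int a"
  have k: "k > 0" "(cmod \<beta>)\<^sup>2 * of_int a' = k" using pos(2) 3 unfolding D_def[symmetric] D k_def by simp_all
  have sq: "sqrt (of_int d) * sqrt (of_int d) = of_int d" using d by simp
  have ac: "of_int a * of_int c = (of_int b)\<^sup>2 + (of_int d :: real)"
    "of_int a' * of_int c' = (of_int b')\<^sup>2 + (of_int d :: real)"
    using arg_cong[OF C, of "of_int :: int \<Rightarrow> real"] arg_cong[OF C', of "of_int :: int \<Rightarrow> real"] by simp_all
  have "k * of_int a' = (cmod (\<beta> * of_int a'))\<^sup>2"
    by (simp add: norm_mult power_mult_distrib k(2)[symmetric] power2_eq_square)
  also have "\<dots> = (cmod \<alpha>)\<^sup>2 * ((of_int p * of_int a + of_int r * of_int b)\<^sup>2 + (of_int r)\<^sup>2 * of_int d)"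
    unfolding 1 using d by (simp add: norm_mult power_mult_distrib cmod_power2)
  also have "\<dots> = k * of_int (a * p^2 + 2 * b * p * r + c * r^2)"
    unfolding k_def using ac(1) unfolding of_int_add of_int_mult of_int_power of_int_numeral by algebra
  finally have e1: "a' = a * p^2 + 2 * b * p * r + c * r^2" using k by (simp del: of_int_add of_int_mult of_int_power)
  have "k * of_int c' * of_int a' = of_int a' * (cmod (\<beta> * (of_int b' + ?w)))\<^sup>2"
  proof -
    have "(cmod (of_int b' + ?w))\<^sup>2 = of_int a' * of_int c'" using d ac(2) by (simp add: cmod_power2)
    then show ?thesis unfolding norm_mult power_mult_distrib k(2)[symmetric] by simp
  qed
  also have "\<dots> = of_int a' * ((cmod \<alpha>)\<^sup>2 * ((of_int q * of_int a + of_int s * of_int b)\<^sup>2 + (of_int s)\<^sup>2 * of_int d))"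
    unfolding 2 using d by (simp add: norm_mult power_mult_distrib cmod_power2)
  also have "\<dots> = k * of_int (a * q^2 + 2 * b * q * s + c * s^2) * of_int a'"
    unfolding k_def using ac(1) unfolding of_int_add of_int_mult of_int_power of_int_numeral by algebra
  finally have e3: "c' = a * q^2 + 2 * b * q * s + c * s^2" using k a'
    by (simp del: of_int_add of_int_mult of_int_power)
  have "k * of_int b' = Re (cnj (\<beta> * of_int a') * (\<beta> * (of_int b' + ?w)))"
    unfolding k(2)[symmetric] cmod_power2 by (simp add: algebra_simps power2_eq_square)
  also have "\<dots> = (cmod \<alpha>)\<^sup>2 * ((of_int p * of_int a + of_int r * of_int b) * (of_int q * of_int a + of_int s * of_int b)
       + of_int r * of_int s * (sqrt (of_int d) * sqrt (of_int d)))"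
    unfolding 1 2 cmod_power2 by (simp add: algebra_simps power2_eq_square)
  also have "\<dots> = k * of_int (a * p * q + b * (p * s + q * r) + c * r * s)"
    unfolding k_def sq using ac(1) unfolding of_int_add of_int_mult of_int_power of_int_numeral by algebra
  finally have e2: "b' = a * p * q + b * (p * s + q * r) + c * r * s" using k
    by (simp del: of_int_add of_int_mult of_int_power)
  have "(a', 2 * b', c') = sl2_act (a, 2 * b, c) p q r s"
    unfolding e1 e2 e3 sl2_act_def by (simp add: algebra_simps)
  then show ?thesis unfolding form_equiv_def using D[unfolded D_def] by blast
qed

section \<open>Composition\<close>

text \<open>\<open>P\<close> and \<open>R\<close> are chosen so that modulo each prime
  \<open>q\<close> of \<open>N\<close> exactly one term survives: \<open>a * P^2\<close> if
  \<open>q\<close> does not divide \<open>a\<close>, \<open>c * R^2\<close> if \<open>q\<close>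
  divides \<open>a\<close> but not \<open>c\<close>, and \<open>b * P * R\<close> if
  \<open>q\<close> divides both, where primitivity keeps \<open>q\<close> from dividing
  \<open>b\<close>.\<close>

lemma primitive_form_represents_coprime:
  assumes prim: "primitive_form (a, b, c)" and N: "N \<noteq> 0"
  shows "\<exists>p r. coprime p r \<and> coprime (a * p^2 + b * p * r + c * r^2) N"
proof -
  define P where "P = \<Prod>{q \<in> prime_factors N. q dvd a \<and> \<not> q dvd c}"
  define R where "R = \<Prod>{q \<in> prime_factors N. \<not> q dvd a}"
  have dvdP: "q dvd P \<longleftrightarrow> q dvd a \<and> \<not> q dvd c" if "q \<in> prime_factors N" for q
  proof -
    have "prime q" using that by (simp add: in_prime_factors_iff)
    then have "q dvd P \<longleftrightarrow> (\<exists>s\<in>{q \<in> prime_factors N. q dvd a \<and> \<not> q dvd c}. q dvd s)"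
      unfolding P_def by (subst prime_dvd_prod_iff) auto
    also have "\<dots> \<longleftrightarrow> q dvd a \<and> \<not> q dvd c"
      using that \<open>prime q\<close> by (auto simp: in_prime_factors_iff dest: primes_dvd_imp_eq)
    finally show ?thesis .
  qed
  have dvdR: "q dvd R \<longleftrightarrow> \<not> q dvd a" if "q \<in> prime_factors N" for q
  proof -
    have "prime q" using that by (simp add: in_prime_factors_iff)
    then have "q dvd R \<longleftrightarrow> (\<exists>s\<in>{q \<in> prime_factors N. \<not> q dvd a}. q dvd s)"
      unfolding R_def by (subst prime_dvd_prod_iff) auto
    also have "\<dots> \<longleftrightarrow> \<not> q dvd a"
      using that \<open>prime q\<close> by (auto simp: in_prime_factors_iff dest: primes_dvd_imp_eq)
    finally show ?thesis .
  qed
  have "coprime P R"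
  proof -
    have "coprime s t" if "s \<in> prime_factors N" "s dvd a" "t \<in> prime_factors N" "\<not> t dvd a" for s t
      using that by (intro primes_coprime) (auto simp: in_prime_factors_iff)
    then show ?thesis unfolding P_def R_def
      by (intro prod_coprime_left prod_coprime_right) auto
  qed
  moreover have "coprime (a * P^2 + b * P * R + c * R^2) N"
  proof (rule ccontr)
    let ?f = "a * P^2 + b * P * R + c * R^2"
    assume "\<not> coprime ?f N"
    then have "\<not> is_unit (gcd ?f N)" by (simp only: is_unit_gcd_iff coprime_iff_gcd_eq_1 not_False_eq_True)
    moreover have "gcd ?f N \<noteq> 0" using N by simp
    ultimately obtain q where q: "prime q" "q dvd gcd ?f N"
      using prime_divisor_exists[of "gcd ?f N"] by blast
    then have qN: "q \<in> prime_factors N" and qf: "q dvd ?f" using N by (auto simp: in_prime_factors_iff)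
    show False
    proof (cases "q dvd a")
      case False
      then have "q dvd R" "\<not> q dvd P" using dvdR[OF qN] dvdP[OF qN] by auto
      then have "q dvd b * P * R + c * R^2" by (intro dvd_add) (auto simp: power2_eq_square)
      then have "q dvd a * P^2" using qf by (metis add.assoc dvd_add_left_iff)
      then show False using q(1) False \<open>\<not> q dvd P\<close> by (auto simp: prime_dvd_mult_iff dest: prime_dvd_power)
    next
      case True
      then have nR: "\<not> q dvd R" using dvdR[OF qN] by auto
      show False
      proof (cases "q dvd c")
        case False
        then have "q dvd P" using dvdP[OF qN] True by auto
        then have "q dvd a * P^2 + b * P * R" by (intro dvd_add) (auto simp: power2_eq_square)
        then have "q dvd c * R^2" using qf by (simp add: dvd_add_right_iff)
        then show False using q(1) False nR by (auto simp: prime_dvd_mult_iff dest: prime_dvd_power)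
      next
        case qc: True
        then have nP: "\<not> q dvd P" using dvdP[OF qN] by auto
        have "q dvd b * P * R" using qf True qc by (simp add: dvd_add_left_iff dvd_add_right_iff)
        then have "q dvd b" using nP nR q(1) by (auto simp: prime_dvd_mult_iff)
        then have "q dvd gcd a (gcd b c)" using True qc by simp
        then have "q dvd 1" using prim by (simp only: primitive_form_def prod.case)
        then show False using q(1) by auto
      qed
    qed
  qed
  ultimately show ?thesis by blast
qed

lemma form_value_pos:
  fixes a b c p r :: int
  assumes "a > 0" and "a * c = b^2 + d" and "d > 0" and "coprime p r"
  shows "a * p^2 + 2 * b * p * r + c * r^2 > 0"
proof -
  have "a * (a * p^2 + 2 * b * p * r + c * r^2) = (a * p + b * r)^2 + d * r^2"
    using assms(2) by algebra
  moreover have "(a * p + b * r)^2 + d * r^2 > 0"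
  proof (cases "r = 0")
    case True
    then show ?thesis using assms by auto
  next
    case False
    then show ?thesis using assms(3) by (simp add: add_nonneg_pos)
  qed
  ultimately show ?thesis using assms(1) by (metis zero_less_mult_pos)
qed

lemma even_middle_coeff:
  assumes "disc (a, B, c) = - 4 * d"
  obtains b where "B = 2 * b" "a * c = b^2 + d"
proof -
  have *: "B^2 = 4 * (a * c - d)" using assms by (simp add: disc_def)
  then have "even (B^2)" by simp
  then obtain b where b: "B = 2 * b" by auto
  have "a * c = b^2 + d" using * unfolding b by (simp add: power2_eq_square)
  then show ?thesis using that b by blast
qed

lemma form_equiv_translate:
  fixes a b c k :: int
  shows "form_equiv (a, 2 * b, c) (a, 2 * (b + k * a), a * k^2 + 2 * b * k + c)"
  unfolding form_equiv_def sl2_act_def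
  by (rule exI[of _ 1], rule exI[of _ k], rule exI[of _ 0], rule exI[of _ 1]) (simp add: algebra_simps)

text \<open>Supplies the existence half of \<open>class_mult\<close>. The second form is moved so
  that its leading coefficient \<open>x2\<close> is prime to \<open>a1\<close>; the Chinese
  remainder theorem then provides translations giving both forms the same middle
  coefficient.\<close>

lemma united_representatives:
  assumes d: "d > 0" and a: "a1 > 0" "a2 > 0"
    and C1: "a1 * c1 = b1^2 + d" and C2: "a2 * c2 = b2^2 + d"
    and prim: "primitive_form (a2, 2 * b2, c2)"
  shows "\<exists>x1 x2 b C. x1 > 0 \<and> x2 > 0 \<and> coprime x1 x2 \<and>
     form_equiv (a1, 2 * b1, c1) (x1, 2 * b, x2 * C) \<and> form_equiv (a2, 2 * b2, c2) (x2, 2 * b, x1 * C)"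
proof -
  obtain p r where pr: "coprime p r" "coprime (a2 * p^2 + 2 * b2 * p * r + c2 * r^2) a1"
    using primitive_form_represents_coprime[OF prim, of a1] a by auto
  obtain s' q' where "s' * p + q' * r = 1" using bezout_int[of p r] pr(1) by auto
  then have "p * s' - (- q') * r = 1" by (simp add: algebra_simps)
  then have eq: "form_equiv (a2, 2 * b2, c2) (sl2_act (a2, 2 * b2, c2) p (- q') r s')"
    unfolding form_equiv_def by blast
  define x2 where "x2 = a2 * p^2 + 2 * b2 * p * r + c2 * r^2"
  obtain B y2 where act: "sl2_act (a2, 2 * b2, c2) p (- q') r s' = (x2, B, y2)"
    unfolding sl2_act_def x2_def by simp
  have "disc (x2, B, y2) = - 4 * d"
    using disc_form_equiv[OF eq] C2 unfolding act by (simp add: disc_def power_mult_distrib)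
  then obtain b2' where b2': "B = 2 * b2'" "x2 * y2 = b2'^2 + d" by (rule even_middle_coeff)
  have cop: "coprime a1 x2" using pr(2) by (simp add: x2_def coprime_commute)
  have x2: "x2 > 0" unfolding x2_def by (rule form_value_pos[OF a(2) C2 d pr(1)])
  obtain e f where ef: "e * a1 + f * x2 = 1" using bezout_int[of a1 x2] cop by auto
  define k1 where "k1 = e * (b2' - b1)"
  define k2 where "k2 = - f * (b2' - b1)"
  have b: "b1 + k1 * a1 = b2' + k2 * x2"
  proof -
    have "b1 + k1 * a1 - (b2' + k2 * x2) = b1 - b2' + (e * a1 + f * x2) * (b2' - b1)"
      by (simp add: k1_def k2_def algebra_simps)
    then show ?thesis by (simp add: ef)
  qed
  define b where "b = b1 + k1 * a1"
  define z1 where "z1 = a1 * k1^2 + 2 * b1 * k1 + c1"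
  define z2 where "z2 = x2 * k2^2 + 2 * b2' * k2 + y2"
  have e1: "form_equiv (a1, 2 * b1, c1) (a1, 2 * b, z1)"
    using form_equiv_translate[of a1 b1 c1 k1] by (simp add: b_def z1_def)
  have e2: "form_equiv (a2, 2 * b2, c2) (x2, 2 * b, z2)"
    using form_equiv_trans[OF eq[unfolded act b2'] form_equiv_translate[of x2 b2' y2 k2]]
    by (simp add: b_def b z2_def)
  have z1: "a1 * z1 = b^2 + d" unfolding z1_def b_def using C1 by algebra
  have z2: "x2 * z2 = b^2 + d" unfolding z2_def b_def b using b2'(2) by algebra
  \<comment> \<open>Equal middle coefficients give \<open>a1 * z1 = x2 * z2\<close>, and coprimality
    splits off the common factor \<open>C\<close>.\<close>
  have "a1 dvd x2 * z2" using z1 z2 by (metis dvd_triv_left)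
  then have "a1 dvd z2" using cop by (simp add: coprime_dvd_mult_right_iff)
  then obtain C where C: "z2 = a1 * C" by blast
  then have "a1 * z1 = a1 * (x2 * C)" using z1 z2 by (simp add: algebra_simps)
  then have "z1 = x2 * C" using a by simp
  then show ?thesis using a(1) x2 cop e1 e2 C by blast
qed

text \<open>The bridge from ideals to the definite description in \<open>class_mult\<close>: any
  united representatives give, by \<open>form_gens_dirichlet\<close>, an ideal equivalent to the
  product of the two given ones, so the composed class does not depend on their choice.\<close>

lemma class_mult_eqI:
  assumes d: "d > 0" and a: "a1 > 0" "a2 > 0" "a3 > 0"
    and C1: "a1 * c1 = b1^2 + d" and C2: "a2 * c2 = b2^2 + d" and C3: "a3 * c3 = b3^2 + d"
    and prim: "primitive_form (a2, 2 * b2, c2)"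
    and eq: "ideal_equiv (form_gens d a1 b1 * form_gens d a2 b2) (form_gens d a3 b3)"
  shows "class_mult (form_class (a1, 2 * b1, c1)) (form_class (a2, 2 * b2, c2)) = form_class (a3, 2 * b3, c3)"
proof -
  let ?F1 = "form_class (a1, 2 * b1, c1)" and ?F2 = "form_class (a2, 2 * b2, c2)"
    and ?F3 = "form_class (a3, 2 * b3, c3)"
  have uniq: "form_class (x1 * x2, B, C) = ?F3"
    if x: "x1 > 0" "x2 > 0" and cop: "coprime x1 x2"
      and 1: "(x1, B, x2 * C) \<in> ?F1" and 2: "(x2, B, x1 * C) \<in> ?F2" for x1 x2 B C
  proof -
    have "disc (x1, B, x2 * C) = - 4 * d"
      using disc_form_equiv[OF 1[unfolded mem_form_class]] C1 by (simp add: disc_def power_mult_distrib)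
    then obtain b where B: "B = 2 * b" and C: "x1 * (x2 * C) = b^2 + d" by (rule even_middle_coeff)
    have C': "x1 * x2 * C = b^2 + d" using C by (simp add: algebra_simps)
    have "ideal_equiv (form_gens d a1 b1) (form_gens d x1 b)"
      using form_equiv_imp_ideal_equiv[OF d a(1) C1] 1 by (simp add: B mem_form_class)
    then have e1: "ideal_equiv (form_gens d a1 b1 * form_gens d a2 b2) (form_gens d x1 b * form_gens d a2 b2)"
      by (rule ideal_equiv_times)
    have "ideal_equiv (form_gens d a2 b2) (form_gens d x2 b)"
      using form_equiv_imp_ideal_equiv[OF d a(2) C2] 2 by (simp add: B mem_form_class)
    then have "ideal_equiv (form_gens d a2 b2 * form_gens d x1 b) (form_gens d x2 b * form_gens d x1 b)"
      by (rule ideal_equiv_times)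
    then have e2: "ideal_equiv (form_gens d x1 b * form_gens d a2 b2) (form_gens d x1 b * form_gens d x2 b)"
      by (simp add: mult.commute)
    have e3: "ideal_equiv (form_gens d x1 b * form_gens d x2 b) (form_gens d (x1 * x2) b)"
      by (rule ideal_equiv_zspan_eq[OF form_gens_dirichlet[OF d cop C']])
    have "ideal_equiv (form_gens d (x1 * x2) b) (form_gens d a3 b3)"
      by (rule ideal_equiv_trans[OF ideal_equiv_sym[OF ideal_equiv_trans[OF e1 ideal_equiv_trans[OF e2 e3]]] eq])
    then show ?thesis
      unfolding form_class_eq_iff B using x a by (intro ideal_equiv_imp_form_equiv[OF d _ a(3) C' C3]) simp_all
  qed
  obtain x1 x2 b C where x: "x1 > 0" "x2 > 0" "coprime x1 x2"
     "form_equiv (a1, 2 * b1, c1) (x1, 2 * b, x2 * C)" "form_equiv (a2, 2 * b2, c2) (x2, 2 * b, x1 * C)"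
    using united_representatives[OF d a(1,2) C1 C2 prim] by blast
  show ?thesis unfolding class_mult_def
  proof (rule the_equality)
    have mem: "(x1, 2 * b, x2 * C) \<in> ?F1" "(x2, 2 * b, x1 * C) \<in> ?F2" using x by (simp_all add: mem_form_class)
    show "\<exists>a1 a2 B C. a1 > 0 \<and> a2 > 0 \<and> coprime a1 a2 \<and> (a1, B, a2 * C) \<in> ?F1 \<and>
        (a2, B, a1 * C) \<in> ?F2 \<and> ?F3 = form_class (a1 * a2, B, C)"
      by (rule exI[of _ x1], rule exI[of _ x2], rule exI[of _ "2 * b"], rule exI[of _ C])
        (simp only: x(1-3) mem uniq[OF x(1-3) mem] simp_thms)
    fix F
    assume "\<exists>a1 a2 B C. a1 > 0 \<and> a2 > 0 \<and> coprime a1 a2 \<and> (a1, B, a2 * C) \<in> ?F1 \<and>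
        (a2, B, a1 * C) \<in> ?F2 \<and> F = form_class (a1 * a2, B, C)"
    then show "F = ?F3" by (elim exE conjE) (simp only: uniq)
  qed
qed

text \<open>The hypothesis bounds the product of the three ideals by a principal ideal of the same norm;
  multiplying by the conjugates turns the inclusion into an equality.\<close>
lemma ideal_equiv_of_principal_bound:
  assumes d: "d > 0" and m: "m1 > 0" "m2 > 0" "m3 > 0"
    and C1: "m1 * c1 = b1^2 + d" and C2: "m2 * c2 = b2^2 + d" and C3: "m3 * c3 = b3^2 + d"
    and prim: "primitive_form (m1, 2 * b1, c1)" "primitive_form (m2, 2 * b2, c2)" "primitive_form (m3, 2 * b3, c3)"
    and norm: "\<kappa> * cnj \<kappa> = of_int (m1 * m2 * m3)"
    and bound: "\<And>h1 h2 h3. h1 \<in> form_gens d m1 b1 \<Longrightarrow> h2 \<in> form_gens d m2 b2 \<Longrightarrow> h3 \<in> form_gens d m3 b3 \<Longrightarrow>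
      \<exists>z \<in> zspan (form_gens d 1 0). h1 * h2 * h3 = \<kappa> * z"
  shows "ideal_equiv (form_gens d m1 b1 * form_gens d m2 b2) (form_gens d m3 (- b3))"
proof -
  let ?O = "form_gens d 1 0"
  let ?G1 = "form_gens d m1 b1" and ?G2 = "form_gens d m2 b2" and ?G3 = "form_gens d m3 b3"
  let ?H1 = "form_gens d m1 (- b1)" and ?H2 = "form_gens d m2 (- b2)" and ?H3 = "form_gens d m3 (- b3)"
  let ?m1 = "of_int m1 :: complex" and ?m2 = "of_int m2 :: complex" and ?m3 = "of_int m3 :: complex"
  have nz: "\<kappa> \<noteq> 0" using norm m by auto
  have "h \<in> {\<kappa>} * zspan ?O" if h: "h \<in> ?G1 * ?G2 * ?G3" for h
  proof -
    obtain h1 h2 h3 where "h = h1 * h2 * h3" "h1 \<in> ?G1" "h2 \<in> ?G2" "h3 \<in> ?G3"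
      using h by (elim set_times_elim) blast
    then show ?thesis using bound[of h1 h2 h3] by (auto simp del: mult_cancel_left)
  qed
  then have sub: "zspan (?G1 * ?G2 * ?G3) \<subseteq> zspan ({\<kappa>} * ?O)"
    by (intro zspan_least) (auto simp: zspan_scale)
  \<comment> \<open>Generators of the opposite lattices are conjugates only up to sign; signs do not
    matter for spans, so the bound can be conjugated.\<close>
  have conj_gens: "\<exists>g \<in> form_gens d m b. h = cnj g \<or> h = - cnj g" if "h \<in> form_gens d m (- b)" for h m b
    using that by (auto simp: form_gens_def)
  have conj_O: "cnj z \<in> zspan ?O" if z: "z \<in> zspan ?O" for z
  proof -
    obtain i j where "z = of_int i * of_int 1 + of_int j * (of_int 0 + sqrt_neg d)"
      using z unfolding form_gens_def zspan_doubleton by blast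
    then have "cnj z = of_int i * of_int 1 + of_int (- j) * (of_int 0 + sqrt_neg d)" by simp
    then show ?thesis unfolding form_gens_def zspan_doubleton by blast
  qed
  have "h \<in> {cnj \<kappa>} * zspan ?O" if h: "h \<in> ?H1 * ?H2 * ?H3" for h
  proof -
    obtain k1 k2 k3 where k: "h = k1 * k2 * k3" "k1 \<in> ?H1" "k2 \<in> ?H2" "k3 \<in> ?H3"
      using h by (elim set_times_elim) blast
    obtain g1 where g1: "g1 \<in> ?G1" "k1 = cnj g1 \<or> k1 = - cnj g1" using conj_gens k by blast
    obtain g2 where g2: "g2 \<in> ?G2" "k2 = cnj g2 \<or> k2 = - cnj g2" using conj_gens k by blast
    obtain g3 where g3: "g3 \<in> ?G3" "k3 = cnj g3 \<or> k3 = - cnj g3" using conj_gens k by blast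
    obtain z where z: "z \<in> zspan ?O" "g1 * g2 * g3 = \<kappa> * z" using bound g1 g2 g3 by blast
    have "h = cnj (g1 * g2 * g3) \<or> h = - cnj (g1 * g2 * g3)" using k g1 g2 g3 by auto
    then have "h = cnj \<kappa> * cnj z \<or> h = cnj \<kappa> * (- cnj z)" unfolding z(2) by simp
    then show ?thesis
      using set_times_intro[of "cnj \<kappa>" "{cnj \<kappa>}"] conj_O[OF z(1)] zspan_minus[OF conj_O[OF z(1)]] by blast
  qed
  then have sub': "zspan (?H1 * ?H2 * ?H3) \<subseteq> zspan ({cnj \<kappa>} * ?O)"
    by (intro zspan_least) (auto simp: zspan_scale)
  have C: "m1 * c1 = (- b1)^2 + d" "m2 * c2 = (- b2)^2 + d" "m3 * c3 = (- b3)^2 + d"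
    using C1 C2 C3 by simp_all
  note unit = form_gens_unit[OF d C1] form_gens_unit[OF d C2] form_gens_unit[OF d C3]
    form_gens_unit[OF d C(1)] form_gens_unit[OF d C(2)] form_gens_unit[OF d C(3)]
  note conj = form_gens_conj[OF d C1 prim(1)] form_gens_conj[OF d C2 prim(2)] form_gens_conj[OF d C3 prim(3)]
  have cancel: "zspan (A * (?O * B)) = zspan (A * B)" if "zspan (?O * B) = zspan B" for A B
    using zspan_times_cong[OF that, of A] by (simp only: mult_ac)
  \<comment> \<open>First inclusion: \<open>m3\<close> times the order is \<open>G3 * H3\<close>,
    and the bound absorbs \<open>G1 * G2 * G3\<close> into \<open>\<kappa>\<close>.\<close>
  have "zspan ({?m3} * (?G1 * ?G2)) = zspan ({?m3} * ?O * (?G1 * ?G2))"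
  proof -
    have "zspan (?O * (?G1 * ?G2)) = zspan (?G1 * ?G2)"
      using zspan_times_cong[OF unit(1), of ?G2] by (simp only: mult_ac)
    from cancel[OF this, of "{?m3}"] show ?thesis by (simp only: mult.assoc)
  qed
  also have "\<dots> = zspan (?G3 * ?H3 * (?G1 * ?G2))" by (rule zspan_times_cong[OF conj(3)[symmetric]])
  also have "\<dots> = zspan ((?G1 * ?G2 * ?G3) * ?H3)" by (simp only: mult_ac)
  also have "\<dots> \<subseteq> zspan ({\<kappa>} * ?O * ?H3)" by (rule zspan_times_mono[OF sub])
  also have "\<dots> = zspan ({\<kappa>} * ?H3)" using cancel[OF unit(6)] by (simp only: mult_ac)
  finally have le: "zspan ({?m3} * (?G1 * ?G2)) \<subseteq> zspan ({\<kappa>} * ?H3)" .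
  \<comment> \<open>Reverse inclusion, scaled by \<open>m1 * m2\<close>: this factor becomes
    \<open>G1 * H1 * G2 * H2\<close>, the conjugated bound absorbs \<open>H1 * H2 * H3\<close> into
    \<open>cnj \<kappa>\<close>, and the norm hypothesis turns
    \<open>\<kappa> * cnj \<kappa>\<close> into \<open>m1 * m2 * m3\<close>.\<close>
  have "zspan ({?m1 * ?m2} * ({\<kappa>} * ?H3)) = zspan ({?m1} * {?m2} * {\<kappa>} * (?O * (?O * ?H3)))"
    using cancel[OF unit(6), of "{?m1} * {?m2} * {\<kappa>} * ?O"] cancel[OF unit(6), of "{?m1} * {?m2} * {\<kappa>}"]
    by (simp only: mult_ac flip: set_times_singletons)
  also have "\<dots> = zspan ({?m1} * ?O * ({?m2} * ?O * {\<kappa>} * ?H3))" by (simp only: mult_ac)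
  also have "\<dots> = zspan (?G1 * ?H1 * ({?m2} * ?O * {\<kappa>} * ?H3))" by (rule zspan_times_cong[OF conj(1)[symmetric]])
  also have "\<dots> = zspan ({?m2} * ?O * (?G1 * ?H1 * {\<kappa>} * ?H3))" by (simp only: mult_ac)
  also have "\<dots> = zspan (?G2 * ?H2 * (?G1 * ?H1 * {\<kappa>} * ?H3))" by (rule zspan_times_cong[OF conj(2)[symmetric]])
  also have "\<dots> = zspan ((?H1 * ?H2 * ?H3) * ({\<kappa>} * ?G1 * ?G2))" by (simp only: mult_ac)
  also have "\<dots> \<subseteq> zspan ({cnj \<kappa>} * ?O * ({\<kappa>} * ?G1 * ?G2))" by (rule zspan_times_mono[OF sub'])
  also have "\<dots> = zspan (({\<kappa> * cnj \<kappa>} * ?G2) * (?O * ?G1))"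
    by (simp only: mult_ac flip: set_times_singletons)
  also have "\<dots> = zspan ({\<kappa> * cnj \<kappa>} * (?G1 * ?G2))"
    unfolding cancel[OF unit(1)] by (simp only: mult_ac)
  also have "\<dots> = zspan ({?m1 * ?m2} * ({?m3} * (?G1 * ?G2)))"
    unfolding norm of_int_mult by (simp only: mult_ac flip: set_times_singletons)
  finally have scaled: "zspan ({?m1 * ?m2} * ({\<kappa>} * ?H3)) \<subseteq> zspan ({?m1 * ?m2} * ({?m3} * (?G1 * ?G2)))" .
  have "?m1 * ?m2 \<noteq> 0" using m by simp
  from zspan_scale_cancel[OF this scaled] le have "zspan ({?m3} * (?G1 * ?G2)) = zspan ({\<kappa>} * ?H3)" by blast
  moreover have "?m3 \<noteq> 0" using m by simp
  ultimately show ?thesis unfolding ideal_equiv_def using nz by blast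
qed

section \<open>Localizations of the quadratic order\<close>

locale complex_subring =
  fixes R :: "complex set"
  assumes one_closed: "1 \<in> R"
    and diff_closed: "x \<in> R \<Longrightarrow> y \<in> R \<Longrightarrow> x - y \<in> R"
    and mult_closed: "x \<in> R \<Longrightarrow> y \<in> R \<Longrightarrow> x * y \<in> R"
begin

lemma zero_closed: "0 \<in> R"
  using diff_closed[OF one_closed one_closed] by simp

lemma minus_closed: "x \<in> R \<Longrightarrow> - x \<in> R"
  using diff_closed[OF zero_closed] by simp

lemma add_closed: "x \<in> R \<Longrightarrow> y \<in> R \<Longrightarrow> x + y \<in> R"
  using diff_closed[of x "- y"] minus_closed[of y] by simp

lemma power_closed: "x \<in> R \<Longrightarrow> x ^ k \<in> R"
  by (induction k) (auto intro: one_closed mult_closed)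

lemma of_nat_closed: "of_nat k \<in> R"
  by (induction k) (auto intro: zero_closed one_closed add_closed)

lemma of_int_closed: "of_int k \<in> R"
  by (cases k rule: int_cases2) (auto intro: of_nat_closed minus_closed)

lemmas closed = zero_closed one_closed add_closed diff_closed minus_closed mult_closed power_closed

end

definition int_loc :: "int \<Rightarrow> complex set" where
  "int_loc p = {of_int a / of_int b | a b. \<not> p dvd b}"

text \<open>Localisation at a rational prime rather than at a prime ideal: \<open>p\<close> need not
  be factored in the order, and membership stays a condition on two rational coordinates.\<close>

definition order_loc :: "int \<Rightarrow> int \<Rightarrow> complex set" where
  "order_loc p d = {x + y * sqrt_neg d | x y. x \<in> int_loc p \<and> y \<in> int_loc p}"

lemma int_locI: "\<not> p dvd b \<Longrightarrow> of_int a / of_int b \<in> int_loc p"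
  by (auto simp: int_loc_def)

lemma int_loc_subring: "prime p \<Longrightarrow> complex_subring (int_loc p)"
proof
  assume p: "prime p"
  then have "\<not> p dvd 1" by auto
  then show "1 \<in> int_loc p" using int_locI[of p 1 1] by simp
  fix x y assume "x \<in> int_loc p" "y \<in> int_loc p"
  then obtain a b a' b' where x: "x = of_int a / of_int b" "\<not> p dvd b"
    and y: "y = of_int a' / of_int b'" "\<not> p dvd b'"
    by (auto simp: int_loc_def)
  then have nz: "b \<noteq> 0" "b' \<noteq> 0" by auto
  have p': "\<not> p dvd b * b'" using x y p by (simp add: prime_dvd_mult_iff)
  have "x - y = of_int (a * b' - a' * b) / of_int (b * b')"
    "x * y = of_int (a * a') / of_int (b * b')"
    unfolding x(1) y(1) using nz by (simp_all add: field_simps)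
  then show "x - y \<in> int_loc p" "x * y \<in> int_loc p" using int_locI[OF p'] by metis+
qed

lemma order_loc_subring:
  assumes p: "prime p" and d: "d > 0"
  shows "complex_subring (order_loc p d)"
proof
  interpret Z: complex_subring "int_loc p" by (rule int_loc_subring[OF p])
  show "1 \<in> order_loc p d" unfolding order_loc_def using Z.one_closed Z.zero_closed by force
  fix x y assume "x \<in> order_loc p d" "y \<in> order_loc p d"
  then obtain a b a' b' where x: "x = a + b * sqrt_neg d" "a \<in> int_loc p" "b \<in> int_loc p"
    and y: "y = a' + b' * sqrt_neg d" "a' \<in> int_loc p" "b' \<in> int_loc p"
    by (auto simp: order_loc_def)
  have "x - y = (a - a') + (b - b') * sqrt_neg d" unfolding x y by (simp add: algebra_simps)
  moreover have "a - a' \<in> int_loc p" "b - b' \<in> int_loc p" using x y by (simp_all add: Z.closed)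
  ultimately show "x - y \<in> order_loc p d" unfolding order_loc_def by blast
  have "x * y = (a * a' - of_int d * b * b') + (a * b' + b * a') * sqrt_neg d"
    unfolding x y using sqrt_neg_square[OF d] by algebra
  moreover have "a * a' - of_int d * b * b' \<in> int_loc p" "a * b' + b * a' \<in> int_loc p"
    using x y by (simp_all add: Z.closed Z.of_int_closed)
  ultimately show "x * y \<in> order_loc p d" unfolding order_loc_def by blast
qed

lemma int_loc_subset_order_loc:
  assumes "prime p" and "x \<in> int_loc p"
  shows "x \<in> order_loc p d"
proof -
  interpret Z: complex_subring "int_loc p" by (rule int_loc_subring[OF assms(1)])
  have "x = x + 0 * sqrt_neg d" by simp
  then show ?thesis unfolding order_loc_def using assms(2) Z.zero_closed by blast
qed

lemma sqrt_neg_in_order_loc: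
  assumes "prime p"
  shows "sqrt_neg d \<in> order_loc p d"
proof -
  interpret Z: complex_subring "int_loc p" by (rule int_loc_subring[OF assms(1)])
  have "sqrt_neg d = 0 + 1 * sqrt_neg d" by simp
  then show ?thesis unfolding order_loc_def using Z.one_closed Z.zero_closed by blast
qed

lemma unit_in_order_loc:
  assumes "prime p" and "\<not> p dvd k"
  shows "1 / of_int k \<in> order_loc p d"
  using int_loc_subset_order_loc[OF assms(1)] int_locI[OF assms(2), of 1] by simp

text \<open>Integral closedness of the localisation. It is applied to the slope and the intercept of
  a line, where only the squares are visibly integral.\<close>

lemma int_loc_of_square:
  assumes p: "prime p" and x: "x \<in> \<rat>" and sq: "x\<^sup>2 \<in> int_loc p"
  shows "x \<in> int_loc p"
proof -
  obtain a b where ab: "b > 0" "coprime a b" "x = of_int a / of_int b" using x by (rule Rats_cases')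
  obtain e f where ef: "x\<^sup>2 = of_int e / of_int f" "\<not> p dvd f" using sq by (auto simp: int_loc_def)
  have nz: "f \<noteq> 0" "b \<noteq> 0" using ef ab by auto
  have "of_int (a^2 * f) = (of_int (e * b^2) :: complex)"
    using ef(1) nz unfolding ab(3) by (simp add: field_simps)
  then have eq: "a^2 * f = e * b^2" by (simp only: of_int_eq_iff)
  have "\<not> p dvd b"
  proof
    assume b: "p dvd b"
    then have "p dvd a^2 * f" unfolding eq by (simp add: power2_eq_square)
    then have "p dvd a" using p ef(2) by (auto simp: prime_dvd_mult_iff dest: prime_dvd_power)
    then show False using b ab(2) p by (meson coprime_common_divisor not_prime_unit)
  qed
  then show ?thesis using ab(3) int_locI by simp
qed

lemma int_of_int_loc:
  assumes "\<And>p. prime p \<Longrightarrow> x \<in> int_loc p"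
  shows "\<exists>k. x = of_int k"
proof -
  have "x \<in> int_loc 2" using assms by simp
  then have "x \<in> \<rat>" by (auto simp: int_loc_def)
  then obtain a b where ab: "b > 0" "coprime a b" "x = of_int a / of_int b" by (rule Rats_cases')
  have "is_unit b"
  proof (rule ccontr)
    assume "\<not> is_unit b"
    then obtain p where p: "prime p" "p dvd b" using prime_divisor_exists[of b] ab(1) by auto
    obtain e f where ef: "x = of_int e / of_int f" "\<not> p dvd f" using assms[OF p(1)] by (auto simp: int_loc_def)
    have nz: "f \<noteq> 0" using ef by auto
    have "of_int (a * f) = (of_int (e * b) :: complex)" using ab ef nz by (simp add: field_simps)
    then have "a * f = e * b" by (simp only: of_int_eq_iff)
    then have "p dvd a * f" using p(2) by simp
    then have "p dvd a" using p ef(2) by (auto simp: prime_dvd_mult_iff)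
    then show False using p ab(2) by (meson coprime_common_divisor not_prime_unit)
  qed
  then have "b = 1" using ab(1) by simp
  then show ?thesis using ab(3) by auto
qed

text \<open>Coordinates with respect to 1 and \<open>w\<close> are unique because \<open>w\<close>
  is not real. Those found at one prime (2 serves as a sample) are therefore integral at all primes,
  hence integers.\<close>

lemma order_of_order_loc:
  assumes d: "d > 0" and z: "\<And>p. prime p \<Longrightarrow> z \<in> order_loc p d"
  shows "z \<in> zspan (form_gens d 1 0)"
proof -
  have real: "x = of_real (Re x)" if "x \<in> int_loc p" for x p
    using that by (auto simp: int_loc_def complex_eq_iff)
  obtain x y where xy: "z = x + y * sqrt_neg d" "x \<in> int_loc 2" "y \<in> int_loc 2"
    using z[of 2] by (auto simp: order_loc_def)
  have "x \<in> int_loc p \<and> y \<in> int_loc p" if p: "prime p" for p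
  proof -
    obtain x' y' where xy': "z = x' + y' * sqrt_neg d" "x' \<in> int_loc p" "y' \<in> int_loc p"
      using z[OF p] by (auto simp: order_loc_def)
    have "of_real (Re x) + of_real (Re y) * sqrt_neg d = of_real (Re x') + of_real (Re y') * sqrt_neg d"
      using xy xy' real by metis
    then have "Re x = Re x' \<and> Re y = Re y'" by (rule sqrt_neg_coords_eq[OF d])
    then show ?thesis using xy xy' real by metis
  qed
  then obtain i j where "x = of_int i" "y = of_int j" using int_of_int_loc by metis
  then have "z = of_int i * of_int 1 + of_int j * (of_int 0 + sqrt_neg d)" by (simp add: xy)
  then show ?thesis unfolding form_gens_def zspan_doubleton by blast
qed

text \<open>For three collinear points \<open>(x\<^sub>i, y\<^sub>i)\<close> of the curve and a further point \<open>(X, Y)\<close>, products of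
  the \<open>y\<^sub>i - Y\<close> with \<open>l X + n + Y\<close> are polynomial multiples of the corresponding \<open>x\<^sub>i - X\<close>,
  so points with singular reduction need no separate treatment.\<close>
lemma line_identity_one:
  fixes X Y x1 y1 l n a4 a6 :: "'a :: field"
  assumes T: "Y^2 = X^3 + a4 * X + a6" and P1: "y1^2 = x1^3 + a4 * x1 + a6" and L1: "y1 = l * x1 + n"
  shows "(y1 - Y) * (l * X + n + Y) = (x1 - X) * ((x1^2 + x1 * X + X^2 + a4) - l * (y1 - Y))"
  using assms by algebra

lemma line_identity_two:
  fixes X Y x1 y1 x2 y2 x3 l n a4 a6 :: "'a :: field"
  assumes T: "Y^2 = X^3 + a4 * X + a6" and P1: "y1^2 = x1^3 + a4 * x1 + a6" and P2: "y2^2 = x2^3 + a4 * x2 + a6"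
    and L1: "y1 = l * x1 + n" and L2: "y2 = l * x2 + n"
    and V1: "l^2 = x1 + x2 + x3" and V2: "a4 - 2 * l * n = x1 * x2 + x1 * x3 + x2 * x3"
  shows "(y1 - Y) * (y2 - Y) * (l * X + n + Y)
    = (x1 - X) * (x2 - X) * (l * (x2^2 + x2 * X + X^2 + a4) - (x1 + x2 + X) * (y2 - Y))"
proof -
  \<comment> \<open>Collinearity rewrites the first quotient as \<open>l * (y2 + Y)\<close> minus a
    multiple of \<open>x2 - X\<close>. Multiplying by \<open>y2 - Y\<close> thus produces a second
    factor \<open>x2 - X\<close>, since both points lie on the curve.\<close>
  have "(x1^2 + x1 * X + X^2 + a4) = l * (y1 + y2) - (x2 - X) * (x1 + x2 + X)"
    unfolding L1 L2 using V1 V2 by algebra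
  then have "(x1^2 + x1 * X + X^2 + a4) - l * (y1 - Y) = l * (y2 + Y) - (x2 - X) * (x1 + x2 + X)"
    by (simp add: algebra_simps)
  moreover have "(y2 - Y) * (y2 + Y) = (x2 - X) * (x2^2 + x2 * X + X^2 + a4)" using T P2 by algebra
  ultimately show ?thesis using line_identity_one[OF T P1 L1] by algebra
qed

text \<open>\<open>V1\<close>, \<open>V2\<close>, \<open>V3\<close> are Vieta's relations for the
  cubic minus \<open>(l * t + n)^2\<close>, whose roots are the \<open>xi\<close>; the identity is
  its value at \<open>t = X\<close> up to sign.\<close>

lemma line_identity_norm:
  fixes X Y x1 x2 x3 l n a4 a6 :: "'a :: field"
  assumes T: "Y^2 = X^3 + a4 * X + a6" 
    and V1: "l^2 = x1 + x2 + x3" and V2: "a4 - 2 * l * n = x1 * x2 + x1 * x3 + x2 * x3"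
    and V3: "n^2 - a6 = x1 * x2 * x3"
  shows "(l * X + n - Y) * (l * X + n + Y) = (x1 - X) * (x2 - X) * (x3 - X)"
  using assms by algebra

text \<open>Each \<open>yi - Y\<close> equals \<open>K + l * (xi - X)\<close>. Expanding the product
  by powers of \<open>K\<close> leaves only terms containing \<open>K * M\<close>, with
  \<open>M = l * X + n + Y\<close>, or all three \<open>xi - X\<close>, and these two products
  agree.\<close>

lemma line_identity_three:
  fixes X Y x1 y1 x2 y2 x3 y3 l n a4 a6 :: "'a :: field"
  assumes T: "Y^2 = X^3 + a4 * X + a6" 
    and L: "y1 = l * x1 + n" "y2 = l * x2 + n" "y3 = l * x3 + n"
    and V1: "l^2 = x1 + x2 + x3" and V2: "a4 - 2 * l * n = x1 * x2 + x1 * x3 + x2 * x3"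
    and V3: "n^2 - a6 = x1 * x2 * x3"
  defines "K \<equiv> l * X + n - Y"
  shows "(y1 - Y) * (y2 - Y) * (y3 - Y) * (l * X + n + Y)
    = (x1 - X) * (x2 - X) * (x3 - X) * (K^2 + K * l * ((x1 - X) + (x2 - X) + (x3 - X))
       + l^2 * ((x1 - X) * (x2 - X) + (x1 - X) * (x3 - X) + (x2 - X) * (x3 - X)) + l^3 * (l * X + n + Y))"
proof -
  have "y1 - Y = K + l * (x1 - X)" "y2 - Y = K + l * (x2 - X)" "y3 - Y = K + l * (x3 - X)"
    unfolding K_def L by (simp_all add: algebra_simps)
  moreover have "K * (l * X + n + Y) = (x1 - X) * (x2 - X) * (x3 - X)"
    unfolding K_def by (rule line_identity_norm[OF T V1 V2 V3])
  moreover have "(K + l * e1) * (K + l * e2) * (K + l * e3) * M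
    = e1 * e2 * e3 * (K^2 + K * l * (e1 + e2 + e3) + l^2 * (e1 * e2 + e1 * e3 + e2 * e3) + l^3 * M)"
    if "K * M = e1 * e2 * e3" for e1 e2 e3 M
    using that by algebra
  ultimately show ?thesis by simp
qed

text \<open>Bookkeeping of denominators: \<open>ki\<close>, \<open>ei\<close>, \<open>ti\<close>
  stand for \<open>Ci\<close>, \<open>xi - X\<close>, \<open>yi - Y\<close>, and the three
  identities treat zero, two and three factors of the \<open>y\<close> type.\<close>

lemma scaled_quotient_identities:
  fixes e1 e2 e3 k1 k2 k3 t1 t2 t3 M :: complex
  assumes "e1 \<noteq> 0" "e2 \<noteq> 0" "e3 \<noteq> 0" "k1 \<noteq> 0" "k2 \<noteq> 0" "k3 \<noteq> 0"
  defines "Z \<equiv> k1 * k2 * k3 * M / ((k1 * k2 * k3)^2 * (e1 * e2 * e3))"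
  shows "k1^2 * e1 * (k2^2 * e2) * (k3^2 * e3) * Z = k1 * k2 * k3 * M"
    and "k1^3 * t1 * (k2^3 * t2) * (k3^2 * e3) * Z = k1 * k2 * (k1 * k2 * k3 * (t1 * t2 * M / (e1 * e2)))"
    and "k1^3 * t1 * (k2^3 * t2) * (k3^3 * t3) * Z
      = k1 * k2 * k3 * (k1 * k2 * k3) * (t1 * t2 * t3 * M / (e1 * e2 * e3))"
  unfolding Z_def using assms(1-6) by (simp_all add: field_simps power2_eq_square power3_eq_cube)

context complex_subring
begin

text \<open>Expanding \<open>h1 * h2 * h3\<close> gives eight terms, sorted by how many factors come
  from \<open>yi - Y\<close>; the line identities cancel the corresponding \<open>xi - X\<close>.
  The last hypotheses say that such a factor occurs only where \<open>Ci\<close> is invertible and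
  the point is integral.\<close>

lemma line_product_closed:
  assumes XY: "X \<in> R" "Y \<in> R" "a4 \<in> R"
    and T: "Y^2 = X^3 + a4 * X + a6"
    and P: "y1^2 = x1^3 + a4 * x1 + a6" "y2^2 = x2^3 + a4 * x2 + a6" "y3^2 = x3^3 + a4 * x3 + a6"
    and L: "y1 = l * x1 + n" "y2 = l * x2 + n" "y3 = l * x3 + n"
    and V1: "l^2 = x1 + x2 + x3" and V2: "a4 - 2 * l * n = x1 * x2 + x1 * x3 + x2 * x3"
    and V3: "n^2 - a6 = x1 * x2 * x3"
    and C: "C1 \<in> R" "C2 \<in> R" "C3 \<in> R" "C1 \<noteq> 0" "C2 \<noteq> 0" "C3 \<noteq> 0"
    and D: "D = C1 * C2 * C3" "D * l \<in> R" "D * n \<in> R"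
    and e: "x1 \<noteq> X" "x2 \<noteq> X" "x3 \<noteq> X"
    and s: "s1 \<in> R" "s2 \<in> R" "s3 \<in> R" and r: "r1 \<in> R" "r2 \<in> R" "r3 \<in> R"
    and h: "h1 = s1 * (C1^2 * (x1 - X)) + r1 * (C1^3 * (y1 - Y))"
      "h2 = s2 * (C2^2 * (x2 - X)) + r2 * (C2^3 * (y2 - Y))"
      "h3 = s3 * (C3^2 * (x3 - X)) + r3 * (C3^3 * (y3 - Y))"
    and r1: "r1 = 0 \<or> 1 / C1 \<in> R \<and> x1 \<in> R \<and> y1 \<in> R"
    and r2: "r2 = 0 \<or> 1 / C2 \<in> R \<and> x2 \<in> R \<and> y2 \<in> R"
    and r3: "r3 = 0 \<or> 1 / C3 \<in> R \<and> x3 \<in> R \<and> y3 \<in> R"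
  shows "h1 * h2 * h3 * (D * (l * X + n + Y)) / (D^2 * ((x1 - X) * (x2 - X) * (x3 - X))) \<in> R"
proof -
  define M where "M = l * X + n + Y"
  define Z where "Z = D * M / (D^2 * ((x1 - X) * (x2 - X) * (x3 - X)))"
  define F1 where "F1 = C1^2 * (x1 - X)"
  define F2 where "F2 = C2^2 * (x2 - X)"
  define F3 where "F3 = C3^2 * (x3 - X)"
  define G1 where "G1 = C1^3 * (y1 - Y)"
  define G2 where "G2 = C2^3 * (y2 - Y)"
  define G3 where "G3 = C3^3 * (y3 - Y)"
  have Dnz: "D \<noteq> 0" using D C by simp
  have DR: "D \<in> R" using D C by (simp add: closed)
  have DM: "D * M \<in> R"
  proof -
    have "D * M = D * l * X + D * n + D * Y" by (simp add: M_def algebra_simps)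
    then show ?thesis using D XY DR by (simp add: closed)
  qed
  have z: "F1 * F2 * F3 * Z \<in> R"
  proof -
    have "F1 * F2 * F3 * Z = D * M"
      unfolding F1_def F2_def F3_def Z_def D(1) using C e by (intro scaled_quotient_identities) simp_all
    then show ?thesis using DM by simp
  qed
  \<comment> \<open>Stated for an arbitrary point of the three; \<open>E\<close> and
    \<open>E'\<close> are the \<open>x\<close>-type factors of the other two, entering only through
    their product.\<close>
  have one: "G * E * E' * Z \<in> R"
    if "y^2 = x^3 + a4 * x + a6" "y = l * x + n" "x \<noteq> X" "x \<in> R" "y \<in> R" "c \<in> R" "c \<noteq> 0"
      "G = c^3 * (y - Y)" "E * E' = c'^2 * e'" "D = c * c'" "c' \<noteq> 0" "e' \<noteq> 0"
      "(x1 - X) * (x2 - X) * (x3 - X) = (x - X) * e'" for x y c G E E' c' e'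
  proof -
    have "G * E * E' * Z = G * (E * E') * Z" by (simp add: mult_ac)
    also have "\<dots> = c * (D * ((y - Y) * M / (x - X)))"
      unfolding Z_def that(9) that(13) that(8) using that(3,7,11,12) unfolding that(10)
      by (simp add: field_simps power2_eq_square power3_eq_cube)
    also have "(y - Y) * M / (x - X) = (x^2 + x * X + X^2 + a4) - l * (y - Y)"
      unfolding M_def line_identity_one[OF T that(1) that(2)] using that(3) by simp
    also have "c * (D * ((x^2 + x * X + X^2 + a4) - l * (y - Y)))
        = c * (D * (x^2 + x * X + X^2 + a4) - D * l * (y - Y))" by (simp add: algebra_simps)
    also have "\<dots> \<in> R" using that D DR XY by (simp add: closed)
    finally show ?thesis .
  qed
  have two: "G * G' * E * Z \<in> R"
    if "y^2 = x^3 + a4 * x + a6" "y = l * x + n" "x \<noteq> X" "x \<in> R" "y \<in> R" "c \<in> R" "c \<noteq> 0" "G = c^3 * (y - Y)"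
     "y'^2 = x'^3 + a4 * x' + a6" "y' = l * x' + n" "x' \<noteq> X" "x' \<in> R" "y' \<in> R" "c' \<in> R" "c' \<noteq> 0" "G' = c'^3 * (y' - Y)"
      "E = c''^2 * (x'' - X)" "D = c * c' * c''" "c'' \<noteq> 0" "x'' \<noteq> X"
      "(x1 - X) * (x2 - X) * (x3 - X) = (x - X) * (x' - X) * (x'' - X)"
      "l^2 = x + x' + x''" "a4 - 2 * l * n = x * x' + x * x'' + x' * x''" for x y c G x' y' c' G' c'' x'' E
  proof -
    have "G * G' * E * Z = c * c' * (D * ((y - Y) * (y' - Y) * M / ((x - X) * (x' - X))))"
      unfolding Z_def that(8) that(16) that(17) that(21) using that(3,7,11,15,19,20) unfolding that(18)
      by (intro scaled_quotient_identities) simp_all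
    also have "(y - Y) * (y' - Y) * M / ((x - X) * (x' - X))
        = l * (x'^2 + x' * X + X^2 + a4) - (x + x' + X) * (y' - Y)"
      unfolding M_def line_identity_two[OF T that(1) that(9) that(2) that(10) that(22) that(23)]
      using that(3,11) by simp
    also have "c * c' * (D * (l * (x'^2 + x' * X + X^2 + a4) - (x + x' + X) * (y' - Y)))
        = c * c' * (D * l * (x'^2 + x' * X + X^2 + a4) - D * ((x + x' + X) * (y' - Y)))"
      by (simp add: algebra_simps)
    also have "\<dots> \<in> R" using that(4,6,12,13,14) D DR XY by (simp add: closed)
    finally show ?thesis .
  qed
  have three: "G1 * G2 * G3 * Z \<in> R"
    if "1 / C1 \<in> R" "1 / C2 \<in> R" "1 / C3 \<in> R" "x1 \<in> R" "y1 \<in> R" "x2 \<in> R" "x3 \<in> R"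
  proof -
    define K where "K = l * X + n - Y"
    \<comment> \<open>All \<open>Ci\<close> are units here, so \<open>l\<close> and \<open>n\<close>
      are integral without the factor \<open>D\<close>.\<close>
    have "l = D * l * (1 / C1 * (1 / C2) * (1 / C3))" using C by (simp add: D)
    then have l: "l \<in> R" using that(1-3) D(2) mult_closed by metis
    have "n = D * n * (1 / C1 * (1 / C2) * (1 / C3))" using C by (simp add: D)
    then have n: "n \<in> R" using that(1-3) D(3) mult_closed by metis
    have "G1 * G2 * G3 * Z = D * D * ((y1 - Y) * (y2 - Y) * (y3 - Y) * M / ((x1 - X) * (x2 - X) * (x3 - X)))"
      unfolding Z_def G1_def G2_def G3_def D(1) using C e by (intro scaled_quotient_identities) simp_all
    also have "(y1 - Y) * (y2 - Y) * (y3 - Y) * M / ((x1 - X) * (x2 - X) * (x3 - X))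
      = K^2 + K * l * ((x1 - X) + (x2 - X) + (x3 - X))
       + l^2 * ((x1 - X) * (x2 - X) + (x1 - X) * (x3 - X) + (x2 - X) * (x3 - X)) + l^3 * (l * X + n + Y)"
      unfolding M_def line_identity_three[OF T L V1 V2 V3] K_def using e by simp
    also have "D * D * \<dots> \<in> R" unfolding K_def by (intro closed DR l n XY that)
    finally show ?thesis .
  qed
  have t100: "r1 * (G1 * F2 * F3 * Z) \<in> R"
    using r1 r(1) one[OF P(1) L(1) e(1) _ _ C(1,4) G1_def, of F2 F3 "C2 * C3" "(x2 - X) * (x3 - X)"] C e
    by (auto simp: closed F2_def F3_def D(1) power_mult_distrib)
  have t010: "r2 * (G2 * F1 * F3 * Z) \<in> R"
    using r2 r(2) one[OF P(2) L(2) e(2) _ _ C(2,5) G2_def, of F1 F3 "C1 * C3" "(x1 - X) * (x3 - X)"] C e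
    by (auto simp: closed F1_def F3_def D(1) power_mult_distrib)
  have t001: "r3 * (G3 * F1 * F2 * Z) \<in> R"
    using r3 r(3) one[OF P(3) L(3) e(3) _ _ C(3,6) G3_def, of F1 F2 "C1 * C2" "(x1 - X) * (x2 - X)"] C e
    by (auto simp: closed F1_def F2_def D(1) power_mult_distrib)
  have "G1 * G2 * F3 * Z \<in> R" if "x1 \<in> R" "y1 \<in> R" "x2 \<in> R" "y2 \<in> R"
    by (rule two[OF P(1) L(1) e(1) that(1,2) C(1,4) G1_def P(2) L(2) e(2) that(3,4) C(2,5) G2_def F3_def _ C(6) e(3)])
      (use V1 V2 in \<open>simp_all add: D(1) mult_ac add_ac\<close>)
  then have t110: "r1 * r2 * (G1 * G2 * F3 * Z) \<in> R"
    using r1 r2 r by (auto intro: mult_closed zero_closed)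
  have "G1 * G3 * F2 * Z \<in> R" if "x1 \<in> R" "y1 \<in> R" "x3 \<in> R" "y3 \<in> R"
    by (rule two[OF P(1) L(1) e(1) that(1,2) C(1,4) G1_def P(3) L(3) e(3) that(3,4) C(3,6) G3_def F2_def _ C(5) e(2)])
      (use V1 V2 in \<open>simp_all add: D(1) mult_ac add_ac\<close>)
  then have t101: "r1 * r3 * (G1 * G3 * F2 * Z) \<in> R"
    using r1 r3 r by (auto intro: mult_closed zero_closed)
  have "G2 * G3 * F1 * Z \<in> R" if "x2 \<in> R" "y2 \<in> R" "x3 \<in> R" "y3 \<in> R"
    by (rule two[OF P(2) L(2) e(2) that(1,2) C(2,5) G2_def P(3) L(3) e(3) that(3,4) C(3,6) G3_def F1_def _ C(4) e(1)])
      (use V1 V2 in \<open>simp_all add: D(1) mult_ac add_ac\<close>)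
  then have t011: "r2 * r3 * (G2 * G3 * F1 * Z) \<in> R"
    using r2 r3 r by (auto intro: mult_closed zero_closed)
  have t111: "r1 * r2 * r3 * (G1 * G2 * G3 * Z) \<in> R"
    using r1 r2 r3 r three by (auto simp: closed)
  have "h1 * h2 * h3 * (D * (l * X + n + Y)) / (D^2 * ((x1 - X) * (x2 - X) * (x3 - X))) = h1 * h2 * h3 * Z"
    by (simp add: Z_def M_def)
  also have "\<dots> = s1 * s2 * s3 * (F1 * F2 * F3 * Z) + s2 * s3 * (r1 * (G1 * F2 * F3 * Z))
      + s1 * s3 * (r2 * (G2 * F1 * F3 * Z)) + s1 * s2 * (r3 * (G3 * F1 * F2 * Z))
      + s3 * (r1 * r2 * (G1 * G2 * F3 * Z)) + s2 * (r1 * r3 * (G1 * G3 * F2 * Z))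
      + s1 * (r2 * r3 * (G2 * G3 * F1 * Z)) + r1 * r2 * r3 * (G1 * G2 * G3 * Z)"
    unfolding h F1_def[symmetric] F2_def[symmetric] F3_def[symmetric] G1_def[symmetric] G2_def[symmetric]
      G3_def[symmetric] by (simp add: algebra_simps)
  also have "\<dots> \<in> R"
    by (intro add_closed mult_closed[OF _ z] mult_closed[OF _ t100] mult_closed[OF _ t010]
        mult_closed[OF _ t001] mult_closed[OF _ t110] mult_closed[OF _ t101] mult_closed[OF _ t011] t111
        mult_closed s)
  finally show ?thesis .
qed

end

section \<open>The ideal of a rational point\<close>

text \<open>The ideal \<open>(m, b + \<surd>-d)\<close> attached to \<open>(A / C\<^sup>2, B / C\<^sup>3)\<close>; here
  \<open>k = C\<^sup>3 / g\<^sup>2\<close> and \<open>\<beta> = B v\<^sup>2 / g\<^sup>2\<close> with \<open>g = gcd C v\<close>.\<close>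
definition point_ideal :: "int \<Rightarrow> int \<Rightarrow> int \<Rightarrow> int \<Rightarrow> int \<Rightarrow> int \<Rightarrow> int \<Rightarrow> bool" where
  "point_ideal u v A B C m b \<longleftrightarrow> C > 0 \<and> m > 0 \<and> m * (gcd C v)^2 = v * (A * v + C^2 * u) \<and> coprime C m \<and>
     (\<exists>k \<beta>. k * (gcd C v)^2 = C^3 \<and> \<beta> * (gcd C v)^2 = B * v^2 \<and> m dvd k * b - \<beta>)"

lemma point_ideal_uminus: "point_ideal u v A B C m b \<Longrightarrow> point_ideal u v A (- B) C m (- b)"
proof -
  assume *: "point_ideal u v A B C m b"
  then obtain k \<beta> where k: "k * (gcd C v)^2 = C^3" "\<beta> * (gcd C v)^2 = B * v^2" "m dvd k * b - \<beta>"
    by (auto simp: point_ideal_def)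
  have "k * (- b) - (- \<beta>) = - (k * b - \<beta>)" by simp
  then have "m dvd k * (- b) - (- \<beta>)" using k(3) by (simp only: dvd_minus_iff)
  moreover have "- \<beta> * (gcd C v)^2 = - B * v^2" using k(2) by simp
  ultimately show ?thesis using * k(1) unfolding point_ideal_def by blast
qed

text \<open>Away from \<open>v\<close> this says that \<open>C^2 * (x - X)\<close> is the leading
  coefficient \<open>m\<close> up to a unit.\<close>

lemma point_ideal_x:
  assumes "point_ideal u v A B C m b" and "v > 0"
  shows "of_int m * (of_int (gcd C v))^2 / (of_int v)^2
    = (of_int C)^2 * (of_int A / (of_int C)^2 - (- of_int u / of_int v) :: complex)"
proof -
  have "of_int (m * (gcd C v)^2) = (of_int (v * (A * v + C^2 * u)) :: complex)"
    using assms by (simp only: point_ideal_def)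
  then have "of_int m * (of_int (gcd C v))^2 = of_int v * (of_int A * of_int v + (of_int C)^2 * of_int u :: complex)"
    by simp
  then show ?thesis using assms by (simp add: point_ideal_def field_simps power2_eq_square)
qed

text \<open>Here \<open>v\<close> and \<open>g\<close> are units. If \<open>p\<close> divides
  \<open>C\<close>, then \<open>m\<close> is a unit as well and the \<open>x\<close>-type generator
  suffices. Otherwise \<open>k\<close> is a unit, and \<open>k * (b + w)\<close> is a multiple of
  \<open>m\<close> plus \<open>\<beta> + k * w\<close>, which is the \<open>y\<close>-type generator
  times \<open>v^2 / g^2\<close>.\<close>

lemma point_ideal_local_good:
  assumes p: "prime p" and d: "d > 0" and v: "v > 0" "\<not> p dvd v"
    and I: "point_ideal u v A B C m b" and h: "h \<in> form_gens d m b"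
  shows "\<exists>s r. s \<in> order_loc p d \<and> r \<in> order_loc p d \<and>
    h = s * ((of_int C)^2 * (of_int A / (of_int C)^2 - (- of_int u / of_int v)))
      + r * ((of_int C)^3 * (of_int B / (of_int C)^3 - (- sqrt_neg d / (of_int v)^2))) \<and>
    (r = 0 \<or> \<not> p dvd C)"
proof -
  interpret R: complex_subring "order_loc p d" by (rule order_loc_subring[OF p d])
  let ?w = "sqrt_neg d"
  define g where "g = gcd C v"
  let ?C = "of_int C :: complex" and ?v = "of_int v :: complex" and ?g = "of_int g :: complex" and ?m = "of_int m :: complex"
  let ?F = "(of_int C)^2 * (of_int A / (of_int C)^2 - (- of_int u / of_int v)) :: complex"
  let ?G = "(of_int C)^3 * (of_int B / (of_int C)^3 - (- sqrt_neg d / (of_int v)^2))"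
  have C0: "C > 0" "m > 0" and cop: "coprime C m" using I by (auto simp: point_ideal_def)
  have g: "g > 0" using C0 by (simp add: g_def)
  have gp: "\<not> p dvd g" using v(2) unfolding g_def by (meson dvd_trans gcd_dvd2)
  have F: "?m * ?g^2 / ?v^2 = ?F" unfolding g_def by (rule point_ideal_x[OF I v(1)])
  have G: "?G = of_int B + ?C^3 * ?w / ?v^2" using C0 by (simp add: field_simps)
  have ginv: "1 / ?g \<in> order_loc p d" by (rule unit_in_order_loc[OF p gp])
  have w: "?w \<in> order_loc p d" by (rule sqrt_neg_in_order_loc[OF p])
  have vg: "?v^2 * (1 / ?g)^2 \<in> order_loc p d" using ginv by (simp add: R.closed R.of_int_closed)
  obtain k \<beta> j where k: "k * g^2 = C^3" "\<beta> * g^2 = B * v^2" and j: "k * b - \<beta> = m * j"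
    using I by (auto simp: point_ideal_def g_def)
  have kc: "of_int k * ?g^2 = ?C^3" "of_int \<beta> * ?g^2 = of_int B * ?v^2"
     "of_int k * of_int b - of_int \<beta> = ?m * of_int j"
    using arg_cong[OF k(1), of "of_int :: int \<Rightarrow> complex"] arg_cong[OF k(2), of "of_int :: int \<Rightarrow> complex"]
      arg_cong[OF j, of "of_int :: int \<Rightarrow> complex"] by simp_all
  have nz: "?g \<noteq> 0" "?v \<noteq> 0" "?m \<noteq> 0" "?C \<noteq> 0" using g v C0 by simp_all
  show ?thesis
  proof (cases "h = ?m")
    case True
    have "h = ?v^2 * (1 / ?g)^2 * ?F + 0 * ?G"
      unfolding True F[symmetric] using nz by (simp add: field_simps)
    then show ?thesis using vg R.zero_closed by blast
  next
    case False
    then have h: "h = of_int b + ?w" using h by (simp add: form_gens_def)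
    show ?thesis
    proof (cases "p dvd C")
      case True
      have "\<not> p dvd m" using True cop p by (meson coprime_common_divisor not_prime_unit)
      then have "1 / ?m \<in> order_loc p d" by (rule unit_in_order_loc[OF p])
      then have s: "h * (1 / ?m) * (?v^2 * (1 / ?g)^2) \<in> order_loc p d"
        unfolding h by (intro R.mult_closed R.add_closed R.of_int_closed w vg)
      have "h = h * (1 / ?m) * (?v^2 * (1 / ?g)^2) * ?F + 0 * ?G"
        unfolding F[symmetric] using nz by (simp add: field_simps)
      then show ?thesis using s R.zero_closed by blast
    next
      case False
      have "\<not> p dvd k"
      proof
        assume "p dvd k"
        then have "p dvd C^3" unfolding k(1)[symmetric] by simp
        then show False using False p by (auto dest: prime_dvd_power)
      qed
      then have kinv: "1 / of_int k \<in> order_loc p d" by (rule unit_in_order_loc[OF p])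
      have k0: "(of_int k :: complex) \<noteq> 0" using kc(1) nz by auto
      have s: "of_int j * (1 / of_int k) * (?v^2 * (1 / ?g)^2) \<in> order_loc p d"
        and r: "(1 / of_int k) * (?v^2 * (1 / ?g)^2) \<in> order_loc p d"
        by (intro R.mult_closed R.of_int_closed vg kinv)+
      have sF: "of_int j * (1 / of_int k) * (?v^2 * (1 / ?g)^2) * ?F = (1 / of_int k) * (?m * of_int j)"
        unfolding F[symmetric] using nz by (simp add: field_simps)
      have "?v^2 * (1 / ?g)^2 * ?G = (of_int B * ?v^2 + ?C^3 * ?w) / ?g^2"
        unfolding G using nz by (simp add: field_simps)
      also have "\<dots> = of_int \<beta> + of_int k * ?w"
        unfolding kc(1)[symmetric] kc(2)[symmetric] using nz by (simp add: field_simps)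
      finally have rG: "(1 / of_int k) * (?v^2 * (1 / ?g)^2) * ?G = (1 / of_int k) * (of_int \<beta> + of_int k * ?w)"
        by (simp only: mult.assoc)
      have "h = of_int j * (1 / of_int k) * (?v^2 * (1 / ?g)^2) * ?F + (1 / of_int k) * (?v^2 * (1 / ?g)^2) * ?G"
        unfolding sF rG h kc(3)[symmetric] using k0 by (simp add: field_simps)
      then show ?thesis using s r False by blast
    qed
  qed
qed

text \<open>If \<open>p\<close> does not divide \<open>C\<close>, then \<open>g\<close> is a unit,
  \<open>p\<close> divides \<open>m\<close> exactly once, and \<open>p\<close> divides
  \<open>\<beta>\<close> and hence \<open>b\<close>. If \<open>p\<close> divides \<open>C\<close>,
  then \<open>m\<close> is a unit and \<open>p\<close> divides \<open>g\<close> exactly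
  once.\<close>

lemma point_ideal_local_bad:
  assumes p: "prime p" and d: "d > 0" and v: "p dvd v" "\<not> p^2 dvd v" "\<not> p dvd u"
    and I: "point_ideal u v A B C m b" and h: "h \<in> form_gens d m b"
  shows "(\<not> p dvd C \<longrightarrow> 1 / of_int (gcd C v) \<in> order_loc p d \<and> of_int p / of_int m \<in> order_loc p d \<and>
      (\<exists>s\<in>order_loc p d. \<exists>r\<in>order_loc p d. h = of_int p * s + sqrt_neg d * r)) \<and>
    (p dvd C \<longrightarrow> of_int p / of_int (gcd C v) \<in> order_loc p d \<and> h / of_int m \<in> order_loc p d)"
proof -
  interpret R: complex_subring "order_loc p d" by (rule order_loc_subring[OF p d])
  let ?w = "sqrt_neg d"
  define g where "g = gcd C v"
  have C0: "C > 0" "m > 0" and cop: "coprime C m" and mg: "m * g^2 = v * (A * v + C^2 * u)"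
    using I by (auto simp: point_ideal_def g_def)
  obtain k \<beta> where k: "k * g^2 = C^3" "\<beta> * g^2 = B * v^2" and j: "m dvd k * b - \<beta>"
    using I by (auto simp: point_ideal_def g_def)
  have w: "?w \<in> order_loc p d" by (rule sqrt_neg_in_order_loc[OF p])
  have hR: "h \<in> order_loc p d" using h w by (auto simp: form_gens_def R.closed R.of_int_closed)
  obtain v1 where v1: "v = p * v1" using v(1) by blast
  have v1p: "\<not> p dvd v1" using v(2) by (auto simp: v1 power2_eq_square)
  show ?thesis
  proof (cases "p dvd C")
    case False
    then have gp: "\<not> p dvd g" unfolding g_def by (meson dvd_trans gcd_dvd1)
    have "\<not> p dvd C^2 * u" using False v(3) p by (auto simp: prime_dvd_mult_iff dest: prime_dvd_power)
    then have a: "\<not> p dvd v1 * (A * v + C^2 * u)"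
      using v1p p v(1) by (simp add: prime_dvd_mult_iff dvd_add_right_iff)
    have "p dvd m * g^2" unfolding mg using v(1) by simp
    then have pm: "p dvd m" using gp p by (auto simp: prime_dvd_mult_iff dest: prime_dvd_power)
    then obtain m1 where m1: "m = p * m1" by blast
    have "p * (m1 * g^2) = p * (v1 * (A * v + C^2 * u))" using mg v1 m1 by (simp add: mult.assoc)
    then have "m1 * g^2 = v1 * (A * v + C^2 * u)" using p by auto
    then have m1p: "\<not> p dvd m1" using a by (metis dvd_mult2)
    have "of_int p / of_int m = (1 / of_int m1 :: complex)" using m1 p by auto
    then have 1: "of_int p / of_int m \<in> order_loc p d" using unit_in_order_loc[OF p m1p] by simp
    have "p dvd \<beta> * g^2" unfolding k(2) using v(1) by (simp add: power2_eq_square)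
    then have "p dvd \<beta>" using gp p by (auto simp: prime_dvd_mult_iff dest: prime_dvd_power)
    moreover have "p dvd k * b - \<beta>" using j pm by (rule dvd_trans[rotated])
    ultimately have "p dvd k * b" by (metis diff_add_cancel dvd_add)
    moreover have "\<not> p dvd k"
    proof
      assume "p dvd k"
      then have "p dvd C^3" unfolding k(1)[symmetric] by simp
      then show False using False p by (auto dest: prime_dvd_power)
    qed
    ultimately have "p dvd b" using p by (simp add: prime_dvd_mult_iff)
    then obtain b1 where b1: "b = p * b1" by blast
    have "h = of_int p * of_int m1 + ?w * 0 \<or> h = of_int p * of_int b1 + ?w * 1"
      using h by (auto simp: form_gens_def m1 b1)
    then have "\<exists>s\<in>order_loc p d. \<exists>r\<in>order_loc p d. h = of_int p * s + ?w * r"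
      using R.of_int_closed R.zero_closed R.one_closed by blast
    then show ?thesis using False 1 unit_in_order_loc[OF p gp] by (simp add: g_def)
  next
    case True
    have mp: "\<not> p dvd m" using True cop p by (meson coprime_common_divisor not_prime_unit)
    have "p dvd g" using True v(1) by (simp add: g_def)
    then obtain g1 where g1: "g = p * g1" by blast
    have "\<not> p dvd g1"
    proof
      assume "p dvd g1"
      then have "p^2 dvd g" unfolding g1 power2_eq_square by simp
      then show False using v(2) unfolding g_def by (meson dvd_trans gcd_dvd2)
    qed
    then have "1 / of_int g1 \<in> order_loc p d" by (rule unit_in_order_loc[OF p])
    moreover have "of_int p / of_int g = (1 / of_int g1 :: complex)" using g1 p by auto
    moreover have "h * (1 / of_int m) \<in> order_loc p d"
      by (intro R.mult_closed hR unit_in_order_loc[OF p mp])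
    ultimately show ?thesis using True by (simp add: g_def)
  qed
qed

context complex_subring
begin

text \<open>The primes dividing \<open>v\<close> are ramified: \<open>\<pi>\<close> stands for such a prime, \<open>w\<close> for \<open>\<surd>-d\<close>, and each
  ideal is locally \<open>(\<pi>, w)\<close> (if \<open>N\<^sub>i\<close>) or trivial.\<close>
lemma ramified_product_closed:
  assumes p: "\<pi> \<in> R" "\<pi> \<noteq> 0" and w: "w \<in> R" "w * w / \<pi> \<in> R"
    and v1: "v1 \<in> R" and E0: "\<exists>s\<in>R. \<exists>r\<in>R. E = \<pi> * s + w * r"
    and E1: "\<not> N1 \<or> \<not> N2 \<or> \<not> N3 \<Longrightarrow> E / \<pi> \<in> R"
    and E2: "\<not> N1 \<and> \<not> N2 \<or> \<not> N1 \<and> \<not> N3 \<or> \<not> N2 \<and> \<not> N3 \<Longrightarrow> E / \<pi>^2 \<in> R"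
    and I1: "N1 \<Longrightarrow> 1 / g1 \<in> R \<and> \<pi> / m1 \<in> R \<and> (\<exists>s\<in>R. \<exists>r\<in>R. h1 = \<pi> * s + w * r)" "\<not> N1 \<Longrightarrow> \<pi> / g1 \<in> R \<and> h1 / m1 \<in> R"
    and I2: "N2 \<Longrightarrow> 1 / g2 \<in> R \<and> \<pi> / m2 \<in> R \<and> (\<exists>s\<in>R. \<exists>r\<in>R. h2 = \<pi> * s + w * r)" "\<not> N2 \<Longrightarrow> \<pi> / g2 \<in> R \<and> h2 / m2 \<in> R"
    and I3: "N3 \<Longrightarrow> 1 / g3 \<in> R \<and> \<pi> / m3 \<in> R \<and> (\<exists>s\<in>R. \<exists>r\<in>R. h3 = \<pi> * s + w * r)" "\<not> N3 \<Longrightarrow> \<pi> / g3 \<in> R \<and> h3 / m3 \<in> R"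
  shows "h1 * h2 * h3 * (\<pi> * v1 / (g1 * g2 * g3) * E) / (m1 * m2 * m3) \<in> R"
proof -
  \<comment> \<open>Ramification enters here: the square of the ideal \<open>(\<pi>, w)\<close> lies
    in \<open>(\<pi>)\<close> because \<open>\<pi>\<close> divides \<open>w * w\<close>.\<close>
  have pair: "x * y / \<pi> \<in> R" if xy: "\<exists>s\<in>R. \<exists>r\<in>R. x = \<pi> * s + w * r" "\<exists>s\<in>R. \<exists>r\<in>R. y = \<pi> * s + w * r" for x y
  proof -
    obtain s r s' r' where *: "s \<in> R" "r \<in> R" "s' \<in> R" "r' \<in> R" "x = \<pi> * s + w * r" "y = \<pi> * s' + w * r'"
      using xy by blast
    have "x * y / \<pi> = \<pi> * s * s' + w * (s * r' + r * s') + (w * w / \<pi>) * r * r'"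
      unfolding * using p(2) by (simp add: field_simps)
    also have "\<dots> \<in> R" by (intro add_closed mult_closed p w *)
    finally show ?thesis .
  qed
  \<comment> \<open>In every case the denominators cost \<open>\<pi>^3\<close>, one factor per
    index, from \<open>mi\<close> or from \<open>gi\<close>. The factor \<open>\<pi> * v1\<close>
    pays for one; the other two come from pairing elements of \<open>(\<pi>, w)\<close>, with
    \<open>E\<close> counted among them, or from the divisibility of \<open>E\<close>.\<close>
  have none: ?thesis if "N1" "N2" "N3"
  proof -
    have "h1 * h2 * h3 * (\<pi> * v1 / (g1 * g2 * g3) * E) / (m1 * m2 * m3)
      = (h1 * h2 / \<pi>) * (h3 * E / \<pi>) * (\<pi> / m1) * (\<pi> / m2) * (\<pi> / m3) * (1 / g1) * (1 / g2) * (1 / g3) * v1"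
      using p(2) by (simp add: field_simps)
    also have "\<dots> \<in> R" using that I1 I2 I3 E0 v1 by (intro mult_closed pair) auto
    finally show ?thesis .
  qed
  have one: "h1 * h2 * h3 * (\<pi> * v1 / (g1 * g2 * g3) * E) / (m1 * m2 * m3) \<in> R"
    if "1 / g1 \<in> R \<and> \<pi> / m1 \<in> R \<and> (\<exists>s\<in>R. \<exists>r\<in>R. h1 = \<pi> * s + w * r)"
      "1 / g2 \<in> R \<and> \<pi> / m2 \<in> R \<and> (\<exists>s\<in>R. \<exists>r\<in>R. h2 = \<pi> * s + w * r)"
      "\<pi> / g3 \<in> R \<and> h3 / m3 \<in> R" "E / \<pi> \<in> R" for h1 h2 h3 g1 g2 g3 m1 m2 m3
  proof -
    have "h1 * h2 * h3 * (\<pi> * v1 / (g1 * g2 * g3) * E) / (m1 * m2 * m3)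
      = (h1 * h2 / \<pi>) * (E / \<pi>) * (\<pi> / m1) * (\<pi> / m2) * (h3 / m3) * (1 / g1) * (1 / g2) * (\<pi> / g3) * v1"
      using p(2) by (simp add: field_simps)
    also have "\<dots> \<in> R" using that v1 by (intro mult_closed pair) auto
    finally show ?thesis .
  qed
  have two: "h1 * h2 * h3 * (\<pi> * v1 / (g1 * g2 * g3) * E) / (m1 * m2 * m3) \<in> R"
    if "1 / g1 \<in> R \<and> \<pi> / m1 \<in> R \<and> (\<exists>s\<in>R. \<exists>r\<in>R. h1 = \<pi> * s + w * r)"
      "\<pi> / g2 \<in> R \<and> h2 / m2 \<in> R"
      "\<pi> / g3 \<in> R \<and> h3 / m3 \<in> R" "E / \<pi>^2 \<in> R" for h1 h2 h3 g1 g2 g3 m1 m2 m3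
  proof -
    have "h1 * h2 * h3 * (\<pi> * v1 / (g1 * g2 * g3) * E) / (m1 * m2 * m3)
      = h1 * (E / \<pi>^2) * (\<pi> / m1) * (h2 / m2) * (h3 / m3) * (1 / g1) * (\<pi> / g2) * (\<pi> / g3) * v1"
      using p(2) by (simp add: field_simps power2_eq_square)
    also have "\<dots> \<in> R" using that v1 p w by (intro mult_closed) (auto simp: closed)
    finally show ?thesis .
  qed
  have three: ?thesis if "\<not> N1" "\<not> N2" "\<not> N3"
  proof -
    have "h1 * h2 * h3 * (\<pi> * v1 / (g1 * g2 * g3) * E) / (m1 * m2 * m3)
      = (E / \<pi>^2) * (h1 / m1) * (h2 / m2) * (h3 / m3) * (\<pi> / g1) * (\<pi> / g2) * (\<pi> / g3) * v1"
      using p(2) by (simp add: field_simps power2_eq_square)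
    also have "\<dots> \<in> R" using that v1 I1 I2 I3 E2 by (intro mult_closed) auto
    finally show ?thesis .
  qed
  show ?thesis
  proof (cases N1; cases N2; cases N3)
    assume N: N1 N2 "\<not> N3"
    show ?thesis using one[OF I1(1)[OF N(1)] I2(1)[OF N(2)] I3(2)[OF N(3)]] E1 N by blast
  next
    assume N: N1 "\<not> N2" N3
    show ?thesis using one[OF I1(1)[OF N(1)] I3(1)[OF N(3)] I2(2)[OF N(2)]] E1 N by (simp add: mult_ac)
  next
    assume N: "\<not> N1" N2 N3
    show ?thesis using one[OF I2(1)[OF N(2)] I3(1)[OF N(3)] I1(2)[OF N(1)]] E1 N by (simp add: mult_ac)
  next
    assume N: N1 "\<not> N2" "\<not> N3"
    show ?thesis using two[OF I1(1)[OF N(1)] I2(2)[OF N(2)] I3(2)[OF N(3)]] E2 N by blast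
  next
    assume N: "\<not> N1" N2 "\<not> N3"
    show ?thesis using two[OF I2(1)[OF N(2)] I1(2)[OF N(1)] I3(2)[OF N(3)]] E2 N by (simp add: mult_ac)
  next
    assume N: "\<not> N1" "\<not> N2" N3
    show ?thesis using two[OF I3(1)[OF N(3)] I1(2)[OF N(1)] I2(2)[OF N(2)]] E2 N by (simp add: mult_ac)
  qed (use none three in blast)+
qed

end

lemma line_ideal_equiv:
  fixes A1 B1 C1 A2 B2 C2 A3 B3 C3 :: int and l n :: complex
  defines "x1 \<equiv> of_int A1 / (of_int C1)^2" and "y1 \<equiv> of_int B1 / (of_int C1)^3"
    and "x2 \<equiv> of_int A2 / (of_int C2)^2" and "y2 \<equiv> of_int B2 / (of_int C2)^3"
    and "x3 \<equiv> of_int A3 / (of_int C3)^2" and "y3 \<equiv> of_int B3 / (of_int C3)^3"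
  assumes dE: "d = dE a4 a6 u v" and d: "d > 0" and v: "v > 0"
    and ram: "\<And>p. prime p \<Longrightarrow> p dvd v \<Longrightarrow> \<not> p^2 dvd v \<and> \<not> p dvd u"
    and I: "point_ideal u v A1 B1 C1 m1 b1" "point_ideal u v A2 B2 C2 m2 b2" "point_ideal u v A3 B3 C3 m3 b3"
    and P: "y1^2 = x1^3 + of_int a4 * x1 + of_int a6" "y2^2 = x2^3 + of_int a4 * x2 + of_int a6"
      "y3^2 = x3^3 + of_int a4 * x3 + of_int a6"
    and ln: "l \<in> \<rat>" "n \<in> \<rat>"
    and L: "y1 = l * x1 + n" "y2 = l * x2 + n" "y3 = l * x3 + n"
    and V1: "l^2 = x1 + x2 + x3" and V2: "of_int a4 - 2 * l * n = x1 * x2 + x1 * x3 + x2 * x3"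
    and V3: "n^2 - of_int a6 = x1 * x2 * x3"
    and c: "m1 * c1 = b1^2 + d" "m2 * c2 = b2^2 + d" "m3 * c3 = b3^2 + d"
    and prim: "primitive_form (m1, 2 * b1, c1)" "primitive_form (m2, 2 * b2, c2)" "primitive_form (m3, 2 * b3, c3)"
  shows "ideal_equiv (form_gens d m1 b1 * form_gens d m2 b2) (form_gens d m3 (- b3))"
proof -
  let ?w = "sqrt_neg d" and ?v = "of_int v :: complex"
  define X :: complex where "X = - of_int u / of_int v"
  define Y where "Y = - ?w / ?v^2"
  define D where "D = C1 * C2 * C3"
  define g1 where "g1 = gcd C1 v"
  define g2 where "g2 = gcd C2 v"
  define g3 where "g3 = gcd C3 v"
  let ?g = "of_int g1 * of_int g2 * of_int g3 :: complex"
  let ?m = "of_int m1 * of_int m2 * of_int m3 :: complex"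
  define M where "M = l * X + n + Y"
  \<comment> \<open>By \<open>point_ideal_x\<close> the scaling is the one for which the norm
    becomes \<open>m1 * m2 * m3\<close>.\<close>
  define \<kappa> where "\<kappa> = ?v^3 * of_int D / ?g * (l * X + n - Y)"
  define \<kappa>' where "\<kappa>' = ?v^3 * of_int D / ?g * M"
  have pos: "C1 > 0" "C2 > 0" "C3 > 0" "m1 > 0" "m2 > 0" "m3 > 0" using I by (auto simp: point_ideal_def)
  then have gpos: "g1 > 0" "g2 > 0" "g3 > 0" by (simp_all add: g1_def g2_def g3_def)
  have nz: "?v \<noteq> 0" "?g \<noteq> 0" "?m \<noteq> 0" "(of_int D :: complex) \<noteq> 0" using v pos gpos by (simp_all add: D_def)
  have T: "Y^2 = X^3 + of_int a4 * X + of_int a6"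
  proof -
    have "of_int d = ?v * ((of_int u)^3 + of_int a4 * of_int u * ?v^2 - of_int a6 * ?v^3)"
      unfolding dE dE_def by simp
    moreover have "?w^2 = - of_int d" using sqrt_neg_square[OF d] by (simp add: power2_eq_square)
    ultimately have "Y^2 = - (?v * ((of_int u)^3 + of_int a4 * of_int u * ?v^2 - of_int a6 * ?v^3)) / ?v^4"
      unfolding Y_def by (simp add: power_divide)
    also have "\<dots> = X^3 + of_int a4 * X + of_int a6"
      unfolding X_def using nz(1) by (simp add: field_simps power2_eq_square power3_eq_cube power4_eq_xxxx)
    finally show ?thesis .
  qed
  have F: "of_int m1 * (of_int g1)^2 / ?v^2 = (of_int C1)^2 * (x1 - X)"
    "of_int m2 * (of_int g2)^2 / ?v^2 = (of_int C2)^2 * (x2 - X)"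
    "of_int m3 * (of_int g3)^2 / ?v^2 = (of_int C3)^2 * (x3 - X)"
    using I[THEN point_ideal_x, OF v] unfolding x1_def x2_def x3_def X_def g1_def g2_def g3_def by blast+
  have e: "x1 \<noteq> X" "x2 \<noteq> X" "x3 \<noteq> X"
  proof -
    have "of_int m1 * (of_int g1)^2 / ?v^2 \<noteq> 0" "of_int m2 * (of_int g2)^2 / ?v^2 \<noteq> 0" "of_int m3 * (of_int g3)^2 / ?v^2 \<noteq> 0"
      using pos gpos v by simp_all
    then show "x1 \<noteq> X" "x2 \<noteq> X" "x3 \<noteq> X" unfolding F by auto
  qed
  have FFF: "(of_int D)^2 * ((x1 - X) * (x2 - X) * (x3 - X)) = ?m * ?g^2 / ?v^6"
  proof -
    have "(of_int D)^2 * ((x1 - X) * (x2 - X) * (x3 - X))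
        = ((of_int C1)^2 * (x1 - X)) * ((of_int C2)^2 * (x2 - X)) * ((of_int C3)^2 * (x3 - X))"
      by (simp add: D_def power_mult_distrib mult_ac)
    also have "\<dots> = ?m * ?g^2 / ?v^6"
      unfolding F[symmetric] using nz(1) by (simp add: field_simps power_mult_distrib flip: power_add)
    finally show ?thesis .
  qed
  have norm: "\<kappa> * \<kappa>' = ?m"
  proof -
    have "\<kappa> * \<kappa>' = (?v^3 / ?g)^2 * ((of_int D)^2 * ((l * X + n - Y) * (l * X + n + Y)))"
      unfolding \<kappa>_def \<kappa>'_def M_def by (simp add: power2_eq_square)
    also have "\<dots> = ?m"
      unfolding line_identity_norm[OF T V1 V2 V3] FFF using nz by (simp add: field_simps flip: power_mult)
    finally show ?thesis .
  qed
  have cnj_rat: "cnj x = x" if "x \<in> \<rat>" for x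
    using that by (auto elim!: Rats_cases')
  \<comment> \<open>Since \<open>l\<close>, \<open>n\<close> and \<open>X\<close> are rational,
    conjugation only changes the sign of \<open>Y\<close>.\<close>
  have cnj: "cnj \<kappa> = \<kappa>'"
    unfolding \<kappa>_def \<kappa>'_def M_def X_def Y_def by (simp add: cnj_rat ln)
  \<comment> \<open>\<open>S\<close> is \<open>D^2 * (x1 + x2 + x3)\<close>, an integer; with
    \<open>V1\<close> it shows that \<open>D * l\<close> has integral square.\<close>
  define S where "S = A1 * (C2 * C3)^2 + A2 * (C1 * C3)^2 + A3 * (C1 * C2)^2"
  have Lsq: "(of_int D * l)^2 = of_int S"
  proof -
    have "(of_int D * l)^2 = (of_int D)^2 * (x1 + x2 + x3)" by (simp add: power_mult_distrib V1)
    also have "\<dots> = of_int S"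
      unfolding S_def D_def x1_def x2_def x3_def using pos by (simp add: field_simps power2_eq_square)
    finally show ?thesis .
  qed
  have Nsq: "(of_int D * n)^2 = of_int (a6 * D^2 + A1 * A2 * A3)"
  proof -
    have "n^2 = of_int a6 + x1 * x2 * x3" using V3 by (simp add: algebra_simps)
    then have "(of_int D * n)^2 = (of_int D)^2 * (of_int a6 + x1 * x2 * x3)" by (simp add: power_mult_distrib)
    also have "\<dots> = of_int (a6 * D^2 + A1 * A2 * A3)"
      unfolding D_def x1_def x2_def x3_def using pos by (simp add: field_simps power2_eq_square)
    finally show ?thesis .
  qed
  have local: "h1 * h2 * h3 * \<kappa>' / ?m \<in> order_loc p d"
    if p: "prime p" and h: "h1 \<in> form_gens d m1 b1" "h2 \<in> form_gens d m2 b2" "h3 \<in> form_gens d m3 b3" for p h1 h2 h3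
  proof -
    interpret Z: complex_subring "int_loc p" by (rule int_loc_subring[OF p])
    interpret R: complex_subring "order_loc p d" by (rule order_loc_subring[OF p d])
    have w: "?w \<in> order_loc p d" by (rule sqrt_neg_in_order_loc[OF p])
    have Ll: "of_int D * l \<in> order_loc p d"
      using int_loc_of_square[OF p, of "of_int D * l"] ln Z.of_int_closed Lsq
      by (intro int_loc_subset_order_loc[OF p]) simp
    have Nl: "of_int D * n \<in> order_loc p d"
      using int_loc_of_square[OF p, of "of_int D * n"] ln Z.of_int_closed[of "a6 * D^2 + A1 * A2 * A3"] Nsq
      by (intro int_loc_subset_order_loc[OF p]) simp
    show ?thesis
    proof (cases "p dvd v")
      case False
      have vinv: "1 / ?v \<in> order_loc p d" by (rule unit_in_order_loc[OF p False])
      have "- of_int u * (1 / ?v) \<in> order_loc p d" "- ?w * (1 / ?v)^2 \<in> order_loc p d"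
        by (intro R.mult_closed R.minus_closed R.of_int_closed R.power_closed vinv w)+
      then have XY: "X \<in> order_loc p d" "Y \<in> order_loc p d" by (simp_all add: X_def Y_def power_divide)
      have coords: "1 / of_int C \<in> order_loc p d \<and> of_int A / (of_int C)^2 \<in> order_loc p d \<and> of_int B / (of_int C)^3 \<in> order_loc p d"
        if "\<not> p dvd C" for A B C
      proof -
        have C: "1 / of_int C \<in> order_loc p d" by (rule unit_in_order_loc[OF p that])
        have "of_int A * (1 / of_int C)^2 \<in> order_loc p d" "of_int B * (1 / of_int C)^3 \<in> order_loc p d"
          by (intro R.mult_closed R.of_int_closed R.power_closed C)+
        then show ?thesis using C by (simp add: power_divide)
      qed
      obtain s1 r1 where 1: "s1 \<in> order_loc p d" "r1 \<in> order_loc p d"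
        "h1 = s1 * ((of_int C1)^2 * (x1 - X)) + r1 * ((of_int C1)^3 * (y1 - Y))" "r1 = 0 \<or> \<not> p dvd C1"
        using point_ideal_local_good[OF p d v False I(1) h(1)] unfolding x1_def y1_def X_def Y_def by blast
      obtain s2 r2 where 2: "s2 \<in> order_loc p d" "r2 \<in> order_loc p d"
        "h2 = s2 * ((of_int C2)^2 * (x2 - X)) + r2 * ((of_int C2)^3 * (y2 - Y))" "r2 = 0 \<or> \<not> p dvd C2"
        using point_ideal_local_good[OF p d v False I(2) h(2)] unfolding x2_def y2_def X_def Y_def by blast
      obtain s3 r3 where 3: "s3 \<in> order_loc p d" "r3 \<in> order_loc p d"
        "h3 = s3 * ((of_int C3)^2 * (x3 - X)) + r3 * ((of_int C3)^3 * (y3 - Y))" "r3 = 0 \<or> \<not> p dvd C3"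
        using point_ideal_local_good[OF p d v False I(3) h(3)] unfolding x3_def y3_def X_def Y_def by blast
      have "h1 * h2 * h3 * (of_int D * (l * X + n + Y)) / ((of_int D)^2 * ((x1 - X) * (x2 - X) * (x3 - X))) \<in> order_loc p d"
      proof (rule R.line_product_closed[OF XY R.of_int_closed T P L V1 V2 V3 R.of_int_closed R.of_int_closed R.of_int_closed
            _ _ _ _ Ll Nl e 1(1) 2(1) 3(1) 1(2) 2(2) 3(2) 1(3) 2(3) 3(3)])
        show "r1 = 0 \<or> 1 / of_int C1 \<in> order_loc p d \<and> x1 \<in> order_loc p d \<and> y1 \<in> order_loc p d"
          using 1(4) coords unfolding x1_def y1_def by blast
        show "r2 = 0 \<or> 1 / of_int C2 \<in> order_loc p d \<and> x2 \<in> order_loc p d \<and> y2 \<in> order_loc p d"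
          using 2(4) coords unfolding x2_def y2_def by blast
        show "r3 = 0 \<or> 1 / of_int C3 \<in> order_loc p d \<and> x3 \<in> order_loc p d \<and> y3 \<in> order_loc p d"
          using 3(4) coords unfolding x3_def y3_def by blast
      qed (use pos in \<open>simp_all add: D_def\<close>)
      \<comment> \<open>The quotient just bounded differs from \<open>\<kappa>' / m\<close> by the
        factor \<open>g / v^3\<close>, which is integral at a prime not dividing
        \<open>v\<close>.\<close>
      then have "?g * (1 / ?v)^3 * (h1 * h2 * h3 * (of_int D * M) / ((of_int D)^2 * ((x1 - X) * (x2 - X) * (x3 - X)))) \<in> order_loc p d"
        unfolding M_def by (intro R.mult_closed R.of_int_closed R.power_closed vinv)
      also have "?g * (1 / ?v)^3 * (h1 * h2 * h3 * (of_int D * M) / ((of_int D)^2 * ((x1 - X) * (x2 - X) * (x3 - X))))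
         = h1 * h2 * h3 * \<kappa>' / ?m"
      proof -
        have "G * (1 / V)^3 * (H * K / (q * G^2 / V^6)) = H * (V^3 * D' / G * M') / q"
          if "V \<noteq> 0" "G \<noteq> 0" "q \<noteq> 0" "K = D' * M'" for G V H K q D' M' :: complex
          using that by (simp add: field_simps power2_eq_square flip: power_add)
        then show ?thesis unfolding FFF \<kappa>'_def using nz by blast
      qed
      finally show ?thesis .
    next
      case True
      then have vu: "\<not> p^2 dvd v" "\<not> p dvd u" using ram[OF p] by auto
      obtain v1 where v1: "v = p * v1" using True by blast
      let ?p = "of_int p :: complex"
      have p0: "?p \<noteq> 0" using p by auto
      \<comment> \<open>This is \<open>v^2 * D * M\<close> with the poles of \<open>X\<close> and
        \<open>Y\<close> cleared, leaving \<open>\<kappa>' = (v / g) * E\<close>.\<close>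
      define E where "E = - (of_int D * l) * of_int u * ?v + of_int D * n * ?v^2 - of_int D * ?w"
      have \<kappa>': "\<kappa>' = ?p * of_int v1 / ?g * E"
      proof -
        have "?v^2 * (of_int D * M) = E"
          unfolding M_def X_def Y_def E_def using nz(1) by (simp add: field_simps power2_eq_square)
        moreover have "\<kappa>' = ?v / ?g * (?v^2 * (of_int D * M))"
          unfolding \<kappa>'_def by (simp add: power2_eq_square power3_eq_cube)
        ultimately show ?thesis by (simp add: v1)
      qed
      have dp: "p dvd d" unfolding dE dE_def using True by simp
      then obtain d1 where d1: "d = p * d1" by blast
      have "of_int d = ?p * of_int d1" by (simp add: d1)
      then have "?w * ?w / ?p = of_int (- d1)" using sqrt_neg_square[OF d] p0 by simp
      then have ww: "?w * ?w / ?p \<in> order_loc p d" by (simp only: R.of_int_closed)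
      have E0: "\<exists>s\<in>order_loc p d. \<exists>r\<in>order_loc p d. E = ?p * s + ?w * r"
      proof (intro bexI)
        show "E = ?p * (- (of_int D * l) * of_int u * of_int v1 + of_int D * n * of_int v * of_int v1) + ?w * (- of_int D)"
          unfolding E_def v1 by (simp add: algebra_simps power2_eq_square)
      qed (intro R.add_closed R.mult_closed R.minus_closed R.of_int_closed Ll Nl)+
      have E1: "E / ?p \<in> order_loc p d" if "\<not> \<not> p dvd C1 \<or> \<not> \<not> p dvd C2 \<or> \<not> \<not> p dvd C3"
      proof -
        have "p dvd D" using that by (auto simp: D_def)
        then obtain D1 where D1: "D = p * D1" by blast
        have "E / ?p = - (of_int D * l) * of_int u * of_int v1 + of_int D * n * of_int v * of_int v1 - of_int D1 * ?w"
          unfolding E_def v1 D1 using p0 by (simp add: field_simps power2_eq_square)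
        also have "\<dots> \<in> order_loc p d"
          by (intro R.add_closed R.diff_closed R.mult_closed R.minus_closed R.of_int_closed Ll Nl w)
        finally show ?thesis .
      qed
      have E2: "E / ?p^2 \<in> order_loc p d"
        if two: "\<not> \<not> p dvd C1 \<and> \<not> \<not> p dvd C2 \<or> \<not> \<not> p dvd C1 \<and> \<not> \<not> p dvd C3 \<or> \<not> \<not> p dvd C2 \<and> \<not> \<not> p dvd C3"
      proof -
        have "p * p dvd D" using two unfolding D_def by (auto intro: mult_dvd_mono dvd_mult dvd_mult2 simp: mult.assoc)
        then obtain D2 where D2: "D = p * p * D2" by blast
        \<comment> \<open>The term \<open>D * l * u * v\<close> contains only one obvious
          \<open>p\<close>. When two of the \<open>Ci\<close> are divisible by \<open>p\<close>,
          every summand of \<open>S\<close> is divisible by \<open>p^2\<close>, so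
          \<open>D * l\<close> supplies the second one.\<close>
        have "p dvd C2 * C3" "p dvd C1 * C3" "p dvd C1 * C2" using two by auto
        then have "p^2 dvd (C2 * C3)^2" "p^2 dvd (C1 * C3)^2" "p^2 dvd (C1 * C2)^2" by (simp_all add: dvd_power_same)
        then have "p^2 dvd S" unfolding S_def by (intro dvd_add dvd_mult)
        then obtain S1 where S1: "S = p^2 * S1" by blast
        have "(of_int D * l / ?p)^2 = of_int S1" unfolding power_divide Lsq S1 using p0 by simp
        then have "(of_int D * l / ?p)^2 \<in> int_loc p" by (simp only: Z.of_int_closed)
        then have Lp: "of_int D * l / ?p \<in> order_loc p d"
          using ln by (intro int_loc_subset_order_loc[OF p] int_loc_of_square[OF p, of "of_int D * l / ?p"]) simp_all
        have "E / ?p^2 = - (of_int D * l / ?p) * of_int u * of_int v1 + of_int D * n * of_int v1 * of_int v1 - of_int D2 * ?w"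
          unfolding E_def v1 using p0 D2 by (simp add: field_simps power2_eq_square)
        also have "\<dots> \<in> order_loc p d"
          by (intro R.add_closed R.diff_closed R.mult_closed R.minus_closed R.of_int_closed Lp Nl w)
        finally show ?thesis .
      qed
      note bad = point_ideal_local_bad[OF p d True vu I(1) h(1)] point_ideal_local_bad[OF p d True vu I(2) h(2)]
        point_ideal_local_bad[OF p d True vu I(3) h(3)]
      show ?thesis unfolding \<kappa>'
        by (rule R.ramified_product_closed[where ?N1.0 = "\<not> p dvd C1" and ?N2.0 = "\<not> p dvd C2" and ?N3.0 = "\<not> p dvd C3",
            OF R.of_int_closed p0 w ww R.of_int_closed E0 E1 E2])
          (use bad in \<open>simp_all add: g1_def g2_def g3_def\<close>)
    qed
  qed
  show ?thesis
  proof (rule ideal_equiv_of_principal_bound[OF d pos(4-6) c prim])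
    show "\<kappa> * cnj \<kappa> = of_int (m1 * m2 * m3)" using norm cnj by simp
    fix h1 h2 h3 assume h: "h1 \<in> form_gens d m1 b1" "h2 \<in> form_gens d m2 b2" "h3 \<in> form_gens d m3 b3"
    have "h1 * h2 * h3 * \<kappa>' / ?m \<in> zspan (form_gens d 1 0)"
      by (rule order_of_order_loc[OF d local[OF _ h]])
    moreover have "h1 * h2 * h3 = \<kappa> * (h1 * h2 * h3 * \<kappa>' / ?m)"
    proof -
      have "\<kappa> * \<kappa>' \<noteq> 0" unfolding norm by (rule nz(3))
      then show ?thesis unfolding norm[symmetric] by auto
    qed
    ultimately show "\<exists>z\<in>zspan (form_gens d 1 0). h1 * h2 * h3 = \<kappa> * z" by blast
  qed
qed

section \<open>Points of the curve\<close>

text \<open>Clearing denominators in lowest terms gives \<open>q^2 * s^3 = t^2 * K\<close> with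
  \<open>K\<close> prime to \<open>s\<close>; hence \<open>s^3 = t^2\<close>, which makes
  \<open>s\<close> a square and \<open>t\<close> a cube of the same integer.\<close>

lemma rational_point_has_rep:
  assumes eq: "y^2 = x^3 + of_int a4 * x + of_int a6"
  shows "\<exists>t. pt_rep x y t"
proof -
  obtain r s where rs: "quotient_of x = (r, s)" by (cases "quotient_of x")
  obtain q t where qt: "quotient_of y = (q, t)" by (cases "quotient_of y")
  have x: "x = of_int r / of_int s" and s: "s > 0" and crs: "coprime r s"
    using rs by (auto simp: quotient_of_div quotient_of_denom_pos quotient_of_coprime)
  have y: "y = of_int q / of_int t" and t: "t > 0" and cqt: "coprime q t"
    using qt by (auto simp: quotient_of_div quotient_of_denom_pos quotient_of_coprime)
  define K where "K = r^3 + a4 * r * s^2 + a6 * s^3"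
  have "of_int (q^2 * s^3) = (of_int (t^2 * K) :: rat)"
    using eq s t unfolding x y K_def by (simp add: field_simps power2_eq_square power3_eq_cube)
  then have e: "q^2 * s^3 = t^2 * K" by (simp only: of_int_eq_iff)
  have "K = (a4 * r * s + a6 * s^2) * s + r^3" by (simp add: K_def algebra_simps power2_eq_square power3_eq_cube)
  then have "gcd s K = gcd s (r^3)" by (simp only: gcd_add_mult)
  moreover have "coprime s (r^3)" using crs by (simp add: coprime_commute)
  ultimately have "coprime s K" by (simp only: coprime_iff_gcd_eq_1)
  then have "coprime (s^3) K" by simp
  moreover have "s^3 dvd t^2 * K" by (simp flip: e)
  ultimately have d1: "s^3 dvd t^2" by (simp only: coprime_dvd_mult_left_iff)
  have "coprime (t^2) (q^2)" using cqt by (simp add: coprime_commute)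
  moreover have "t^2 dvd q^2 * s^3" unfolding e by simp
  ultimately have d2: "t^2 dvd s^3" by (simp only: coprime_dvd_mult_right_iff)
  have st: "s^3 = t^2" using zdvd_antisym_nonneg[OF _ _ d1 d2] s t by simp
  have "s^2 dvd t^2" unfolding st[symmetric] by (simp add: le_imp_power_dvd)
  then have "s dvd t" by simp
  then obtain C where C: "t = s * C" by blast
  have "s^2 * s = s^2 * C^2" using st unfolding C by (simp add: power_mult_distrib power2_eq_square power3_eq_cube)
  then have sC: "s = C^2" using s by simp
  have C0: "C > 0" using t s by (simp add: C zero_less_mult_iff)
  have tC: "t = C^3" unfolding C sC by (simp add: power2_eq_square power3_eq_cube)
  have "pt_rep x y (r, q, C)"
    unfolding pt_rep_def prod.case x y using C0 crs cqt by (simp add: sC tC)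
  then show ?thesis ..
qed

text \<open>\<open>Phi\<close> chooses the representations of a point and of its negative
  independently; this relates the two choices.\<close>

lemma pt_rep_unique_up_to_sign:
  assumes "pt_rep x y (A, B, C)" and "pt_rep x (- y) (A', B', C')"
  shows "A' = A \<and> B' = - B \<and> C' = C"
proof -
  have 1: "C > 0" "coprime A C" "x = of_int A / of_int (C^2)" "y = of_int B / of_int (C^3)"
    and 2: "C' > 0" "coprime A' C'" "x = of_int A' / of_int (C'^2)" "- y = of_int B' / of_int (C'^3)"
    using assms by (auto simp: pt_rep_def)
  have "of_int A / of_int (C^2) = (of_int A' / of_int (C'^2) :: rat)" using 1 2 by simp
  then have "of_int (A * C'^2) = (of_int (A' * C^2) :: rat)" using 1(1) 2(1) by (simp add: field_simps)
  then have e: "A * C'^2 = A' * C^2" by (simp only: of_int_eq_iff)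
  have "C^2 dvd A * C'^2" unfolding e by simp
  then have "C^2 dvd C'^2" using 1(2) by (simp add: coprime_dvd_mult_right_iff coprime_commute)
  then have d1: "C dvd C'" by simp
  have "C'^2 dvd A' * C^2" unfolding e[symmetric] by simp
  then have "C'^2 dvd C^2" using 2(2) by (simp add: coprime_dvd_mult_right_iff coprime_commute)
  then have d2: "C' dvd C" by simp
  have C: "C' = C" using zdvd_antisym_nonneg[OF _ _ d2 d1] 1 2 by simp
  have "A' = A" using e 1(1) by (simp add: C)
  moreover have "of_int B' / of_int (C^3) = (of_int (- B) / of_int (C^3) :: rat)" using 1(4) 2(4) by (simp add: C)
  then have "B' = - B" using 1(1) by (simp flip: of_int_minus)
  ultimately show ?thesis using C by blast
qed

lemma pt_rep_curve_equation:
  assumes "pt_rep x y (A, B, C)" and "y^2 = x^3 + of_int a4 * x + of_int a6"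
  shows "B^2 = A^3 + a4 * A * C^4 + a6 * C^6"
proof -
  have 1: "C > 0" "x = of_int A / of_int (C^2)" "y = of_int B / of_int (C^3)"
    using assms(1) by (auto simp: pt_rep_def)
  have "(of_int C :: rat)^6 * y^2 = (of_int C)^6 * (x^3 + of_int a4 * x + of_int a6)" using assms(2) by simp
  moreover have "(of_int C :: rat)^6 * y^2 = of_int (B^2)"
    unfolding 1 using 1(1) by (simp add: field_simps flip: power_mult power_add)
  moreover have "(of_int C :: rat)^6 * (x^3 + of_int a4 * x + of_int a6) = of_int (A^3 + a4 * A * C^4 + a6 * C^6)"
    unfolding 1 using 1(1) by (simp add: field_simps flip: power_mult power_add)
  ultimately show ?thesis by (simp only: of_int_eq_iff)
qed

text \<open>With \<open>f\<close> the cubic of the curve, \<open>f x - f X\<close> is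
  \<open>(x - X) * (x^2 + x * X + X^2 + a4)\<close>. Here \<open>x = A / C^2\<close> and
  \<open>X = - u / v\<close>, where \<open>f X = - d / v^4\<close>, and all is multiplied by
  \<open>C^6 * v^4\<close>.\<close>

lemma curve_norm_identity:
  fixes A B C u v a4 a6 :: int
  assumes "B^2 = A^3 + a4 * A * C^4 + a6 * C^6"
  shows "B^2 * v^4 + C^6 * dE a4 a6 u v
    = v * (A * v + C^2 * u) * ((A * v)^2 - C^2 * u * (A * v) + (C^2 * u)^2 + a4 * C^4 * v^2)"
  unfolding dE_def using assms by algebra

text \<open>If \<open>x\<close> were at most \<open>X = - u / v < 0\<close>, then
  \<open>x^2 + x * X + X^2 + a4\<close> would be at least \<open>3 * X^2 + a4 > 0\<close>, making
  the right side of \<open>curve_norm_identity\<close> nonpositive, whereas its left side is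
  positive.\<close>

lemma point_right_of_specialization:
  fixes A B C u v a4 a6 :: int
  assumes eq: "B^2 = A^3 + a4 * A * C^4 + a6 * C^6" and C: "C > 0"
    and u: "u > 0" and v: "v > 0" and der: "3 * u^2 + a4 * v^2 > 0" and d: "dE a4 a6 u v > 0"
  shows "A * v + C^2 * u > 0"
proof (rule ccontr)
  assume "\<not> ?thesis"
  then have neg: "A * v \<le> - (C^2 * u)" by simp
  define \<tau> where "\<tau> = C^2 * u"
  have \<tau>: "\<tau> > 0" using C u by (simp add: \<tau>_def)
  let ?q = "(A * v)^2 - C^2 * u * (A * v) + (C^2 * u)^2 + a4 * C^4 * v^2"
  have "(A * v)^2 \<ge> \<tau>^2" using power_mono[of \<tau> "- (A * v)" 2] neg \<tau> by (simp add: \<tau>_def)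
  moreover have "- (\<tau> * (A * v)) \<ge> \<tau>^2"
    using mult_left_mono[of \<tau> "- (A * v)" \<tau>] neg \<tau> by (simp add: \<tau>_def power2_eq_square)
  ultimately have "?q \<ge> 3 * \<tau>^2 + a4 * C^4 * v^2" unfolding \<tau>_def[symmetric] by linarith
  moreover have "3 * \<tau>^2 + a4 * C^4 * v^2 = C^4 * (3 * u^2 + a4 * v^2)"
    unfolding \<tau>_def by (simp add: algebra_simps power2_eq_square power4_eq_xxxx)
  moreover have "C^4 * (3 * u^2 + a4 * v^2) > 0" using C der by simp
  ultimately have "?q > 0" by linarith
  then have "v * (A * v + C^2 * u) * ?q \<le> 0"
    using v neg by (simp add: mult_le_0_iff zero_le_mult_iff)
  moreover have "B^2 * v^4 + C^6 * dE a4 a6 u v > 0"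
    using C d by (intro add_nonneg_pos) simp_all
  ultimately show False using curve_norm_identity[OF eq, of v u] by linarith
qed

text \<open>A prime dividing all coefficients has square dividing \<open>b^2 + d\<close>. If it
  divides \<open>b\<close>, this contradicts squarefreeness; otherwise it is 2 with \<open>b\<close>
  odd, which forces \<open>d mod 4 = 3\<close>.\<close>

lemma primitive_of_fundamental:
  fixes m b c d :: int
  assumes sf: "squarefree d" and mod4: "d mod 4 = 1 \<or> d mod 4 = 2" and eq: "m * c = b^2 + d"
  shows "primitive_form (m, 2 * b, c)"
proof (rule ccontr)
  assume "\<not> ?thesis"
  then have "gcd m (gcd (2 * b) c) \<noteq> 1" by (simp add: primitive_form_def)
  then have nu: "\<not> is_unit (gcd m (gcd (2 * b) c))" by (simp only: is_unit_gcd_iff not_False_eq_True)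
  moreover have "gcd m (gcd (2 * b) c) \<noteq> 0"
  proof
    assume "gcd m (gcd (2 * b) c) = 0"
    then have "d = 0" using eq by simp
    then show False using mod4 by simp
  qed
  ultimately obtain p where p: "prime p" "p dvd m" "p dvd 2 * b" "p dvd c"
    using prime_divisor_exists[of "gcd m (gcd (2 * b) c)"] by auto
  have pp: "p^2 dvd m * c" unfolding power2_eq_square using p by (intro mult_dvd_mono)
  show False
  proof (cases "p dvd b")
    case True
    then have "p^2 dvd b^2" by simp
    then have "p^2 dvd d" using pp eq by (metis dvd_add_right_iff)
    then show False using squarefreeD[OF sf] p(1) by auto
  next
    case False
    then have "p dvd 2" using p by (simp add: prime_dvd_mult_iff)
    then have "p = 2" using p(1) by (simp add: primes_dvd_imp_eq)
    then have "4 dvd b^2 + d" "odd b" using pp eq False by auto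
    then obtain k where "b = 2 * k + 1" by (auto elim: oddE)
    then have "b^2 = 4 * (k^2 + k) + 1" by (simp add: power2_eq_square algebra_simps)
    then show False using \<open>4 dvd b^2 + d\<close> mod4 by presburger
  qed
qed

locale map_suitable_data =
  fixes a4 a6 u v d :: int
  assumes dE: "d = dE a4 a6 u v" and d: "d > 0" and u: "u > 0" and v: "v > 0"
    and der: "3 * u^2 + a4 * v^2 > 0"
    and sf: "squarefree d" and mod4: "d mod 4 = 1 \<or> d mod 4 = 2"
begin

text \<open>\<open>v\<close> divides the squarefree \<open>d\<close>; a prime dividing both
  \<open>u\<close> and \<open>v\<close> would also divide the cofactor of \<open>v\<close> in
  \<open>d\<close>.\<close>

lemma v_ramified:
  assumes p: "prime p" and "p dvd v"
  shows "\<not> p^2 dvd v \<and> \<not> p dvd u"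
proof -
  have nd: "\<not> p^2 dvd d" using squarefreeD[OF sf] p by auto
  have "v dvd d" by (simp add: dE dE_def)
  then have "\<not> p^2 dvd v" using nd by (meson dvd_trans)
  moreover have "\<not> p dvd u"
  proof
    assume "p dvd u"
    then have "p dvd u * (u^2 + a4 * v^2) + v * (- a6 * v^2)" using assms by simp
    also have "u * (u^2 + a4 * v^2) + v * (- a6 * v^2) = u^3 + a4 * u * v^2 - a6 * v^3"
      by (simp add: algebra_simps power2_eq_square power3_eq_cube)
    finally have "p * p dvd d" unfolding dE dE_def using assms by (intro mult_dvd_mono)
    then show False using nd by (simp add: power2_eq_square)
  qed
  ultimately show ?thesis by simp
qed

lemma primitive: "m * c = b^2 + d \<Longrightarrow> primitive_form (m, 2 * b, c)"
  by (rule primitive_of_fundamental[OF sf mod4])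

text \<open>Unwinds the choices and integer divisions in \<open>Phi\<close> once and for all; later
  arguments see only \<open>point_ideal\<close>, where \<open>\<mu>\<close> is replaced by the
  congruence between \<open>k * b\<close> and \<open>\<beta>\<close>.\<close>

lemma Phi_point:
  assumes on: "on_curve a4 a6 (Pt x y)"
  shows "\<exists>A B C m b c. pt_rep x y (A, B, C) \<and> point_ideal u v A B C m b \<and> m * c = b^2 + d \<and>
    Phi a4 a6 u v (Pt x y) = form_class (m, 2 * b, c)"
proof -
  obtain A B C where t: "(SOME t. pt_rep x y t) = (A, B, C)" by (cases "SOME t. pt_rep x y t")
  have "\<exists>t. pt_rep x y t" using on by (intro rational_point_has_rep[of y x a4 a6]) simp
  from someI_ex[OF this] have rep: "pt_rep x y (A, B, C)" unfolding t .
  have C: "C > 0" and AC: "coprime A C" using rep by (auto simp: pt_rep_def)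
  have eq: "B^2 = A^3 + a4 * A * C^4 + a6 * C^6" using pt_rep_curve_equation[OF rep] on by simp
  have apos: "A * v + C^2 * u > 0"
    using point_right_of_specialization[OF eq C u v der] d by (simp add: dE)
  define g where "g = gcd C v"
  have g: "g > 0" using C by (simp add: g_def)
  obtain C' where C': "C = g * C'" unfolding g_def using gcd_dvd1 by blast
  obtain v' where v': "v = g * v'" unfolding g_def using gcd_dvd2 by blast
  have cop': "coprime C' v'"
  proof -
    have "gcd (g * C') (g * v') = g" unfolding C'[symmetric] v'[symmetric] by (simp add: g_def)
    then have "g * gcd C' v' = g * 1" using g gcd_mult_distrib_int[of g C' v'] by simp
    then show ?thesis using g by (simp add: coprime_iff_gcd_eq_1)
  qed
  \<comment> \<open>A common prime would have its square dividing \<open>v\<close>. Coprimality is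
    what lets \<open>m\<close> be prime to \<open>C\<close>.\<close>
  have gv': "coprime g v'"
  proof (rule ccontr)
    assume "\<not> coprime g v'"
    moreover have "gcd g v' \<noteq> 0" using g by simp
    ultimately obtain p where p: "prime p" "p dvd g" "p dvd v'"
      using prime_divisor_exists[of "gcd g v'"] by (auto simp: coprime_iff_gcd_eq_1)
    then have "p * p dvd g * v'" by (intro mult_dvd_mono)
    then show False using v_ramified[OF p(1)] p(2) by (simp add: v' power2_eq_square)
  qed
  define a' where "a' = A * v' + g * C'^2 * u"
  define m where "m = v' * a'"
  define k where "k = g * C'^3"
  define \<beta> where "\<beta> = B * v'^2"
  have a: "A * v + C^2 * u = g * a'" by (simp add: C' v' a'_def algebra_simps power2_eq_square)
  have mg: "v * (A * v + C^2 * u) = g^2 * m" unfolding a unfolding v' m_def by (simp add: power2_eq_square)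
  have mdiv: "v * (A * v + C^2 * u) div g^2 = m" unfolding mg using g by simp
  have kg: "C^3 = g^2 * k" unfolding C' k_def by (simp add: power2_eq_square power3_eq_cube)
  have kdiv: "C^3 div g^2 = k" unfolding kg using g by simp
  have \<beta>g: "B * v^2 = g^2 * \<beta>" unfolding v' \<beta>_def by (simp add: power2_eq_square)
  have \<beta>div: "B * v^2 div g^2 = \<beta>" unfolding \<beta>g using g by simp
  have "B^2 * v^4 = g^4 * \<beta>^2" unfolding v' \<beta>_def by (simp add: power2_eq_square power4_eq_xxxx)
  then have \<beta>2div: "B^2 * v^4 div g^4 = \<beta>^2" using g by simp
  have mpos: "m > 0"
  proof -
    have "g^2 * m > 0" unfolding mg[symmetric] using v apos by simp
    then show ?thesis using g by (simp add: zero_less_mult_iff)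
  qed
  have cop: "coprime C m"
  proof -
    have "coprime A g" "coprime A C'" using AC by (simp_all add: C')
    then have "coprime g (A * v')" "coprime C' (A * v')" using gv' cop' by (simp_all add: coprime_commute)
    moreover have "gcd g a' = gcd g (A * v')" "gcd C' a' = gcd C' (A * v')"
      unfolding a'_def using gcd_add_mult[of g "C'^2 * u" "A * v'"] gcd_add_mult[of C' "g * C' * u" "A * v'"]
      by (simp_all add: algebra_simps power2_eq_square)
    ultimately have "coprime g a'" "coprime C' a'" by (simp_all only: coprime_iff_gcd_eq_1)
    then show ?thesis unfolding C' m_def using gv' cop' by simp
  qed
  have kC: "coprime k m" using cop unfolding C' k_def by simp
  define \<mu> where "\<mu> = (SOME \<mu>. (k * \<mu>) mod m = 1 mod m)"
  obtain r s where "r * k + s * m = 1" using bezout_int[of k m] kC by auto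
  then have "k * r = 1 + m * (- s)" by (simp add: algebra_simps)
  then have "(k * r) mod m = 1 mod m" by (metis mod_mult_self2)
  then have "(k * \<mu>) mod m = 1 mod m" unfolding \<mu>_def by (rule someI)
  then have \<mu>: "m dvd k * \<mu> - 1" by (simp only: mod_eq_dvd_iff)
  define b where "b = \<mu> * \<beta>"
  have "k * b - \<beta> = (k * \<mu> - 1) * \<beta>" by (simp add: b_def algebra_simps)
  then have kb: "m dvd k * b - \<beta>" using \<mu> by simp
  have I: "point_ideal u v A B C m b"
    unfolding point_ideal_def g_def[symmetric] using C mpos mg cop kg \<beta>g kb by (metis mult.commute)
  \<comment> \<open>This is \<open>curve_norm_identity\<close> divided by \<open>g^4\<close>. Since
    \<open>k\<close> is invertible modulo \<open>m\<close> and \<open>k * b\<close> is congruent to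
    \<open>\<beta>\<close>, it yields that \<open>m\<close> divides \<open>b^2 + d\<close>.\<close>
  have "\<beta>^2 + k^2 * d = m * (g^2 * C'^4 * u^2 - g * C'^2 * u * A * v' + A^2 * v'^2 + a4 * g^4 * C'^4 * v'^2)"
    unfolding \<beta>_def k_def m_def a'_def dE dE_def v' using eq[unfolded C'] by algebra
  then have "m dvd \<beta>^2 + k^2 * d" by simp
  moreover have "k^2 * (b^2 + d) = (k * b - \<beta>) * (k * b + \<beta>) + (\<beta>^2 + k^2 * d)" by algebra
  ultimately have "m dvd k^2 * (b^2 + d)" using kb by simp
  moreover have "coprime m (k^2)" using kC by (simp add: coprime_commute)
  ultimately have "m dvd b^2 + d" by (simp add: coprime_dvd_mult_right_iff)
  then have mc: "m * ((b^2 + d) div m) = b^2 + d" by simp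
  have "Phi a4 a6 u v (Pt x y) = form_class (Phi_form a4 a6 u v (A, B, C) \<mu>)"
    by (simp only: Phi.simps t Let_def prod.case g_def[symmetric] mdiv kdiv \<mu>_def)
  also have "Phi_form a4 a6 u v (A, B, C) \<mu> = (m, 2 * b, (b^2 + d) div m)"
    by (simp add: Phi_form_def Let_def g_def[symmetric] mdiv \<beta>div \<beta>2div b_def dE power_mult_distrib)
  finally show ?thesis using rep I mc by blast
qed

end

text \<open>Vieta's relations for the line; the one for the sum of roots is the definition of
  \<open>x3\<close>. For a chord the second follows by subtracting the curve equations and
  cancelling \<open>x2 - x1\<close>; for a tangent it encodes the slope formula.\<close>

lemma chord_tangent_line:
  fixes x1 y1 x2 y2 a4 a6 :: rat
  assumes P1: "y1^2 = x1^3 + a4 * x1 + a6" and P2: "y2^2 = x2^3 + a4 * x2 + a6"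
    and ne: "\<not> (x1 = x2 \<and> y1 = - y2)"
    and l: "l = (if x1 = x2 then (3 * x1^2 + a4) / (2 * y1) else (y2 - y1) / (x2 - x1))"
    and n: "n = y1 - l * x1" and x3: "x3 = l^2 - x1 - x2"
  shows "y2 = l * x2 + n" and "a4 - 2 * l * n = x1 * x2 + x1 * x3 + x2 * x3"
    and "n^2 - a6 = x1 * x2 * x3"
proof -
  have y1: "y1 = l * x1 + n" by (simp add: n)
  have "y2 = l * x2 + n \<and> a4 - 2 * l * n = x1 * x2 + x1 * x3 + x2 * x3"
  proof (cases "x1 = x2")
    case True
    then have "y1^2 = y2^2" using P1 P2 by simp
    then have y: "y2 = y1" using True ne by (auto simp: power2_eq_iff)
    then have "y1 \<noteq> 0" using ne True by auto
    then have "2 * y1 * l = 3 * x1^2 + a4" using True l by simp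
    then have "a4 - 2 * l * n = 2 * l^2 * x1 - 3 * x1^2" unfolding y1 by (simp add: algebra_simps power2_eq_square)
    also have "\<dots> = x1 * x2 + x1 * x3 + x2 * x3" unfolding x3 True by (simp add: algebra_simps power2_eq_square)
    finally show ?thesis using True y y1 by simp
  next
    case False
    then have "l * (x2 - x1) = y2 - y1" using l by simp
    then have y2: "y2 = l * x2 + n" by (simp add: n algebra_simps)
    have "(x2 - x1) * (a4 - 2 * l * n - (x1 * x2 + x1 * x3 + x2 * x3)) = 0"
      using P1 P2 unfolding y1 y2 x3 by algebra
    then show ?thesis using y2 False by simp
  qed
  then show "y2 = l * x2 + n" and V2: "a4 - 2 * l * n = x1 * x2 + x1 * x3 + x2 * x3" by auto
  show "n^2 - a6 = x1 * x2 * x3" using P1 V2 x3 unfolding y1 by algebra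
qed

section \<open>The cases of the addition law\<close>

context map_suitable_data
begin

lemma Phi_form_rep:
  assumes "on_curve a4 a6 P"
  shows "\<exists>m b c. m > 0 \<and> m * c = b^2 + d \<and> Phi a4 a6 u v P = form_class (m, 2 * b, c)"
proof (cases P)
  case Inf
  then show ?thesis by (intro exI[of _ 1] exI[of _ 0] exI[of _ d]) (simp add: dE)
next
  case (Pt x y)
  then show ?thesis using Phi_point assms unfolding point_ideal_def by blast
qed

lemma class_mult_Phi_Inf:
  assumes "on_curve a4 a6 P"
  shows "class_mult (Phi a4 a6 u v Inf) (Phi a4 a6 u v P) = Phi a4 a6 u v P"
    and "class_mult (Phi a4 a6 u v P) (Phi a4 a6 u v Inf) = Phi a4 a6 u v P"
proof -
  obtain m b c where m: "m > 0" "m * c = b^2 + d" "Phi a4 a6 u v P = form_class (m, 2 * b, c)"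
    using Phi_form_rep[OF assms] by blast
  have Inf: "Phi a4 a6 u v Inf = form_class (1, 2 * 0, d)" by (simp add: dE)
  have one: "1 * d = 0^2 + d" by simp
  have "primitive_form (1, 0, d)" by (simp add: primitive_form_def)
  moreover have "ideal_equiv (form_gens d 1 0 * form_gens d m b) (form_gens d m b)"
    by (rule ideal_equiv_zspan_eq[OF form_gens_unit[OF d m(2)]])
  moreover from this have "ideal_equiv (form_gens d m b * form_gens d 1 0) (form_gens d m b)"
    by (simp only: mult.commute)
  ultimately show "class_mult (Phi a4 a6 u v Inf) (Phi a4 a6 u v P) = Phi a4 a6 u v P"
    and "class_mult (Phi a4 a6 u v P) (Phi a4 a6 u v Inf) = Phi a4 a6 u v P"
    unfolding Inf m(3) using m(1,2) one primitive d by (intro class_mult_eqI[OF d]; simp)+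
qed

text \<open>The second ideal is the conjugate of the first: both have the same \<open>m\<close> and
  \<open>k\<close>, the \<open>\<beta>\<close> are opposite, and invertibility of \<open>k\<close>
  modulo \<open>m\<close> gives that \<open>m\<close> divides \<open>b + b'\<close>. The product of
  conjugates is principal.\<close>

lemma class_mult_Phi_uminus:
  assumes "on_curve a4 a6 (Pt x y)"
  shows "class_mult (Phi a4 a6 u v (Pt x y)) (Phi a4 a6 u v (Pt x (- y))) = Phi a4 a6 u v Inf"
proof -
  obtain A B C m b c where 1: "pt_rep x y (A, B, C)" "point_ideal u v A B C m b" "m * c = b^2 + d"
    "Phi a4 a6 u v (Pt x y) = form_class (m, 2 * b, c)"
    using Phi_point[OF assms] by blast
  obtain A' B' C' m' b' c' where 2: "pt_rep x (- y) (A', B', C')" "point_ideal u v A' B' C' m' b'" "m' * c' = b'^2 + d"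
    "Phi a4 a6 u v (Pt x (- y)) = form_class (m', 2 * b', c')"
    using Phi_point[of x "- y"] assms by auto
  have eq: "A' = A" "B' = - B" "C' = C" using pt_rep_unique_up_to_sign[OF 1(1) 2(1)] by auto
  define g where "g = gcd C v"
  have pos: "m > 0" "m' > 0" "C > 0" using 1(2) 2(2) by (auto simp: point_ideal_def)
  then have g: "g > 0" by (simp add: g_def)
  have "m * g^2 = m' * g^2" using 1(2) 2(2) by (simp add: point_ideal_def eq g_def)
  then have m': "m' = m" using g by simp
  obtain k \<beta> where k: "k * g^2 = C^3" "\<beta> * g^2 = B * v^2" "m dvd k * b - \<beta>"
    using 1(2) by (auto simp: point_ideal_def g_def)
  obtain k' \<beta>' where k': "k' * g^2 = C^3" "\<beta>' * g^2 = - B * v^2" "m dvd k' * b' - \<beta>'"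
    using 2(2) by (auto simp: point_ideal_def g_def eq m')
  have "k' * g^2 = k * g^2" "\<beta>' * g^2 = - \<beta> * g^2" using k k' by simp_all
  then have eqk: "k' = k" "\<beta>' = - \<beta>" using g by (simp_all only: mult_cancel_right) auto
  have "m dvd (k * b - \<beta>) + (k' * b' - \<beta>')" using k(3) k'(3) by (rule dvd_add)
  then have "m dvd k * (b + b')" by (simp add: eqk algebra_simps)
  moreover have "coprime m k"
  proof -
    have "coprime (C^3) m" using 1(2) by (simp add: point_ideal_def)
    then show ?thesis unfolding k(1)[symmetric] by (simp add: coprime_commute)
  qed
  ultimately have "m dvd b + b'" by (simp add: coprime_dvd_mult_right_iff)
  then obtain j where j: "b + b' = m * j" by blast
  have one: "{1 :: complex} * X = X" for X by (auto simp: set_times_def)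
  have "zspan (form_gens d m b') = zspan (form_gens d m (- b))"
  proof (rule zspan_eqI)
    have gen: "of_int m \<in> zspan (form_gens d m x)" "of_int x + sqrt_neg d \<in> zspan (form_gens d m x)" for x
      by (simp_all add: form_gens_def zspan_gen)
    have sub: "form_gens d m x \<subseteq> zspan G" if "of_int m \<in> zspan G" "of_int x + sqrt_neg d \<in> zspan G" for x G
      using that by (simp add: form_gens_def)
    have "b' = j * m - b" using j by (simp add: algebra_simps)
    then have "of_int b' + sqrt_neg d = of_int j * of_int m + (of_int (- b) + sqrt_neg d)"
      "of_int (- b) + sqrt_neg d = (of_int b' + sqrt_neg d) - of_int j * of_int m" by simp_all
    then have "of_int b' + sqrt_neg d \<in> zspan (form_gens d m (- b))"
      "of_int (- b) + sqrt_neg d \<in> zspan (form_gens d m b')"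
      using gen zspan_add zspan_diff zspan_of_int_mult by metis+
    then show "form_gens d m b' \<subseteq> zspan (form_gens d m (- b))" "form_gens d m (- b) \<subseteq> zspan (form_gens d m b')"
      using sub[OF gen(1)] by blast+
  qed
  then have "zspan (form_gens d m b' * form_gens d m b) = zspan (form_gens d m (- b) * form_gens d m b)"
    by (rule zspan_times_cong)
  also have "\<dots> = zspan ({of_int m} * form_gens d 1 0)"
    using form_gens_conj[OF d 1(3) primitive[OF 1(3)]] by (simp only: mult.commute)
  finally have "zspan ({1} * (form_gens d m b * form_gens d m b')) = zspan ({of_int m} * form_gens d 1 0)"
    unfolding one by (simp only: mult.commute)
  moreover have "(of_int m :: complex) \<noteq> 0" using pos by simp
  ultimately have "ideal_equiv (form_gens d m b * form_gens d m b') (form_gens d 1 0)"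
    unfolding ideal_equiv_def using one_neq_zero by blast
  then have "class_mult (form_class (m, 2 * b, c)) (form_class (m, 2 * b', c')) = form_class (1, 2 * 0, d)"
    using 1(3) 2(3) primitive pos by (intro class_mult_eqI[OF d]) (simp_all add: m')
  then show ?thesis unfolding 1(4) 2(4) m' by (simp add: dE)
qed

text \<open>The third point on the line is the negative of the sum, so the ideal relation is applied
  to \<open>(x3, - y3)\<close> with \<open>- b3\<close>; its conjugated conclusion then returns
  \<open>b3\<close>.\<close>

lemma class_mult_Phi_chord_tangent:
  assumes on1: "on_curve a4 a6 (Pt x1 y1)" and on2: "on_curve a4 a6 (Pt x2 y2)"
    and ne: "\<not> (x1 = x2 \<and> y1 = - y2)"
  shows "Phi a4 a6 u v (ec_add a4 (Pt x1 y1) (Pt x2 y2))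
    = class_mult (Phi a4 a6 u v (Pt x1 y1)) (Phi a4 a6 u v (Pt x2 y2))"
proof -
  define l where "l = (if x1 = x2 then (3 * x1^2 + of_int a4) / (2 * y1) else (y2 - y1) / (x2 - x1))"
  define n where "n = y1 - l * x1"
  define x3 where "x3 = l^2 - x1 - x2"
  define y3 where "y3 = l * (x1 - x3) - y1"
  have add: "ec_add a4 (Pt x1 y1) (Pt x2 y2) = Pt x3 y3"
    using ne by (simp add: Let_def l_def x3_def y3_def del: if_split) 
  have P1: "y1^2 = x1^3 + of_int a4 * x1 + of_int a6" and P2: "y2^2 = x2^3 + of_int a4 * x2 + of_int a6"
    using on1 on2 by simp_all
  note line = chord_tangent_line[OF P1 P2 ne l_def n_def x3_def]
  have L1: "y1 = l * x1 + n" by (simp add: n_def)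
  have L3: "- y3 = l * x3 + n" by (simp add: y3_def n_def algebra_simps)
  have V1: "l^2 = x1 + x2 + x3" by (simp add: x3_def)
  have P3: "(- y3)^2 = x3^3 + of_int a4 * x3 + of_int a6"
    unfolding L3 using line(2,3) V1 by algebra
  then have on3: "on_curve a4 a6 (Pt x3 y3)" by simp
  obtain A1 B1 C1 m1 b1 c1 where 1: "pt_rep x1 y1 (A1, B1, C1)" "point_ideal u v A1 B1 C1 m1 b1" "m1 * c1 = b1^2 + d"
    "Phi a4 a6 u v (Pt x1 y1) = form_class (m1, 2 * b1, c1)"
    using Phi_point[OF on1] by blast
  obtain A2 B2 C2 m2 b2 c2 where 2: "pt_rep x2 y2 (A2, B2, C2)" "point_ideal u v A2 B2 C2 m2 b2" "m2 * c2 = b2^2 + d"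
    "Phi a4 a6 u v (Pt x2 y2) = form_class (m2, 2 * b2, c2)"
    using Phi_point[OF on2] by blast
  obtain A3 B3 C3 m3 b3 c3 where 3: "pt_rep x3 y3 (A3, B3, C3)" "point_ideal u v A3 B3 C3 m3 b3" "m3 * c3 = b3^2 + d"
    "Phi a4 a6 u v (Pt x3 y3) = form_class (m3, 2 * b3, c3)"
    using Phi_point[OF on3] by blast
  have coords: "complex_of_rat x = of_int A / (of_int C)^2 \<and> complex_of_rat y = of_int B / (of_int C)^3"
    if "pt_rep x y (A, B, C)" for x y A B C
    using that by (simp add: pt_rep_def of_rat_divide of_rat_power)
  have c1: "of_int A1 / (of_int C1)^2 = complex_of_rat x1" "of_int B1 / (of_int C1)^3 = complex_of_rat y1"
    using coords[OF 1(1)] by simp_all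
  have c2: "of_int A2 / (of_int C2)^2 = complex_of_rat x2" "of_int B2 / (of_int C2)^3 = complex_of_rat y2"
    using coords[OF 2(1)] by simp_all
  have c3: "of_int A3 / (of_int C3)^2 = complex_of_rat x3" "of_int (- B3) / (of_int C3)^3 = complex_of_rat (- y3)"
    using coords[OF 3(1)] by (simp_all add: of_rat_minus)
  have cast: "complex_of_rat y^2 = complex_of_rat x^3 + of_int a4 * complex_of_rat x + of_int a6"
    if "y^2 = x^3 + of_int a4 * x + of_int a6" for x y
    using arg_cong[OF that, of complex_of_rat] by (simp add: of_rat_add of_rat_mult of_rat_power)
  have castl: "complex_of_rat y = complex_of_rat l * complex_of_rat x + complex_of_rat n" if "y = l * x + n" for x y
    using arg_cong[OF that, of complex_of_rat] by (simp add: of_rat_add of_rat_mult)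
  have c3': "m3 * c3 = (- b3)^2 + d" using 3(3) by simp
  have "ideal_equiv (form_gens d m1 b1 * form_gens d m2 b2) (form_gens d m3 (- (- b3)))"
  proof (rule line_ideal_equiv[where l = "of_rat l" and n = "of_rat n", OF dE d v v_ramified 1(2) 2(2) point_ideal_uminus[OF 3(2)],
        unfolded c1 c2 c3, OF _ _ cast[OF P1] cast[OF P2] cast[OF P3] _ _ castl[OF L1] castl[OF line(1)] castl[OF L3]
        _ _ _ 1(3) 2(3) c3' primitive[OF 1(3)] primitive[OF 2(3)] primitive[OF c3']])
    show "(complex_of_rat l)^2 = of_rat x1 + of_rat x2 + of_rat x3"
      using arg_cong[OF V1, of complex_of_rat] by (simp add: of_rat_add of_rat_power)
    show "of_int a4 - 2 * complex_of_rat l * of_rat n = of_rat x1 * of_rat x2 + of_rat x1 * of_rat x3 + of_rat x2 * of_rat x3"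
      using arg_cong[OF line(2), of complex_of_rat] by (simp add: of_rat_add of_rat_diff of_rat_mult)
    show "(complex_of_rat n)^2 - of_int a6 = of_rat x1 * of_rat x2 * of_rat x3"
      using arg_cong[OF line(3), of complex_of_rat] by (simp add: of_rat_diff of_rat_power of_rat_mult)
  qed simp_all
  then have "ideal_equiv (form_gens d m1 b1 * form_gens d m2 b2) (form_gens d m3 b3)" by simp
  moreover have "m1 > 0" "m2 > 0" "m3 > 0" using 1(2) 2(2) 3(2) by (auto simp: point_ideal_def)
  ultimately show ?thesis
    unfolding add 1(4) 2(4) 3(4) using class_mult_eqI[OF d _ _ _ 1(3) 2(3) 3(3) primitive[OF 2(3)]] by simp
qed

end

theorem theorem1p1:
  fixes a4 a6 u v :: int
  assumes "ec_nonsingular a4 a6"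
    and "map_suitable a4 a6 u v"
    and "fundamental_disc (- DE a4 a6 u v)"
  shows "\<forall>P Q. on_curve a4 a6 P \<longrightarrow> on_curve a4 a6 Q \<longrightarrow>
           Phi a4 a6 u v (ec_add a4 P Q) = class_mult (Phi a4 a6 u v P) (Phi a4 a6 u v Q)"
proof (intro allI impI)
  fix P Q assume on: "on_curve a4 a6 P" "on_curve a4 a6 Q"
  define d where "d = dE a4 a6 u v"
  \<comment> \<open>Excludes the odd alternative of \<open>fundamental_disc\<close>; in the
    remaining one \<open>m = - d\<close>, and the residues 2 and 3 of \<open>m\<close> become 2 and
    1 for \<open>d\<close>.\<close>
  have "(- (4 * d)) mod 4 \<noteq> 1" by presburger
  then obtain m where m: "- (4 * d) = 4 * m" "m mod 4 = 2 \<or> m mod 4 = 3" "squarefree m"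
    using assms(3) by (auto simp: fundamental_disc_def DE_def d_def)
  have md: "m = - d" using m(1) by simp
  have "d mod 4 = 1 \<or> d mod 4 = 2" using m(2) unfolding md by presburger
  moreover have "squarefree d" using m(3) by (simp add: md)
  ultimately interpret map_suitable_data a4 a6 u v d
    using assms(2) by unfold_locales (auto simp: map_suitable_def DE_def d_def)
  show "Phi a4 a6 u v (ec_add a4 P Q) = class_mult (Phi a4 a6 u v P) (Phi a4 a6 u v Q)"
  proof (cases P)
    case Inf
    then show ?thesis using class_mult_Phi_Inf(1)[OF on(2)] by simp
  next
    case P: (Pt x1 y1)
    show ?thesis
    proof (cases Q)
      case Inf
      then show ?thesis using class_mult_Phi_Inf(2)[OF on(1)] P by simp
    next
      case Q: (Pt x2 y2)
      show ?thesis
      proof (cases "x1 = x2 \<and> y1 = - y2")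
        case True
        then have "ec_add a4 P Q = Inf" "Q = Pt x1 (- y1)" by (simp_all add: P Q)
        then show ?thesis using class_mult_Phi_uminus[of x1 y1] on(1) P by simp
      next
        case False
        then show ?thesis using class_mult_Phi_chord_tangent on P Q by blast
      qed
    qed
  qed
qed

end
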